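(* Let $p$ be a prime and $n\ge1$. The Cantor–Bendixson rank of the space ${\rm Sub}(\mathcal{L}_{n,p})$ is equal to the Cantor–Bendixson rank of the poset $\mathcal{Q}$.
   Context: $\mathcal{L}_{n,p}=(\mathbb{Z}/p\mathbb{Z})^n\wr\mathbb{Z}$. ${\rm Sub}(G)$ is the compact space of subgroups of $G$ with topology induced from $\{0,1\}^G$; the Cantor–Bendixson rank of a Polish space $X$ is the least ordinal $\alpha$ with $X^\alpha=X^{\alpha+1}$, where $X^0=X$, $X^{\alpha+1}$ is the set of non-isolated points of $X^\alpha$, and $X^\lambda=\bigcap_{\alpha<\lambda}X^\alpha$ for limit $\lambda$. $\mathcal{Q}$ is the set $\mathbb{N}\times(\mathbb{N}\cup\{0\})$ with the relation $(t',r')<(t,r)$ iff $t'\mid t$ and $t'r'<tr$. For a set $\mathcal{P}$ with a transitive relation: $\mathcal{P}_0$ is the set of minimal elements, $\bar{\mathcal{P}}_0=\mathcal{P}\setminus\mathcal{P}_0$; $\mathcal{P}_{\alpha+1}$ is $\mathcal{P}_\alpha$ together with the minimal elements of $\bar{\mathcal{P}}_\alpha$, $\bar{\mathcal{P}}_{\alpha+1}=\mathcal{P}\setminus\mathcal{P}_{\alpha+1}$; at limits $\mathcal{P}_\beta=\bigcup_{\alpha<\beta}\mathcal{P}_\alpha$, $\bar{\mathcal{P}}_\beta=\bigcap_{\alpha<\beta}\bar{\mathcal{P}}_\alpha$; $r_{CB}(\mathcal{P})$ is the minimal $\alpha$ with $\bar{\mathcal{P}}_\alpha=\bar{\mathcal{P}}_{\alpha+1}$.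 *)

theory Defs
  imports "HOL-Analysis.Analysis" "HOL-Algebra.Group"
begin

text \<open>Elements are pairs (f,k): f is a finitely supported lamp configuration
  Z -> (Z/pZ)^n (coordinates j < n, entries in {0..p-1}, zero for j >= n),
  k is the position in Z. The product is the semidirect product
  (f,k)(g,l) = (f + k.g, k+l) with (k.g)(i) = g(i-k).\<close>

definition lamp_carrier :: "nat \<Rightarrow> nat \<Rightarrow> ((int \<Rightarrow> nat \<Rightarrow> int) \<times> int) set" where
  "lamp_carrier n p = {(f, k). (\<forall>i j. 0 \<le> f i j \<and> f i j < int p)
      \<and> (\<forall>i j. n \<le> j \<longrightarrow> f i j = 0) \<and> finite {i. \<exists>j. f i j \<noteq> 0}}"

definition lamplighter :: "nat \<Rightarrow> nat \<Rightarrow> ((int \<Rightarrow> nat \<Rightarrow> int) \<times> int) monoid" where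
  "lamplighter n p = \<lparr> carrier = lamp_carrier n p,
      mult = (\<lambda>(f, k) (g, l). (\<lambda>i j. (f i j + g (i - k) j) mod int p, k + l)),
      one = (\<lambda>i j. 0, 0) \<rparr>"

definition Sub_space :: "('a, 'b) monoid_scheme \<Rightarrow> ('a \<Rightarrow> bool) topology" where
  "Sub_space G = subtopology
      (product_topology (\<lambda>_. discrete_topology (UNIV :: bool set)) (carrier G))
      ((\<lambda>H. restrict (\<lambda>g. g \<in> H) (carrier G)) ` {H. subgroup H G})"

definition CB_deriv :: "'a topology \<Rightarrow> 'a set \<Rightarrow> 'a set" where
  "CB_deriv X S = S \<inter> (X derived_set_of S)"

definition CB_seq :: "'a topology \<Rightarrow> 'i::wellorder \<Rightarrow> 'a set" where
  "CB_seq X = wfrec {(x, y). x < y} (\<lambda>F \<alpha>.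
      if (\<forall>\<beta>. \<not> \<beta> < \<alpha>) then topspace X
      else if (\<exists>\<beta>. \<beta> < \<alpha> \<and> (\<forall>\<gamma>. \<gamma> < \<alpha> \<longrightarrow> \<gamma> \<le> \<beta>))
        then CB_deriv X (F (THE \<beta>. \<beta> < \<alpha> \<and> (\<forall>\<gamma>. \<gamma> < \<alpha> \<longrightarrow> \<gamma> \<le> \<beta>)))
      else \<Inter> (F ` {\<beta>. \<beta> < \<alpha>}))"

definition is_CB_rank :: "'a topology \<Rightarrow> 'i::wellorder \<Rightarrow> bool" where
  "is_CB_rank X \<alpha> \<longleftrightarrow>
     CB_seq X \<alpha> = CB_deriv X (CB_seq X \<alpha>) \<and>
     (\<forall>\<beta>. \<beta> < \<alpha> \<longrightarrow> CB_seq X \<beta> \<noteq> CB_deriv X (CB_seq X \<beta>))"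

definition minimals :: "('a \<Rightarrow> 'a \<Rightarrow> bool) \<Rightarrow> 'a set \<Rightarrow> 'a set" where
  "minimals R S = {x \<in> S. \<not> (\<exists>y \<in> S. R y x)}"

definition poset_seq :: "('a \<Rightarrow> 'a \<Rightarrow> bool) \<Rightarrow> 'a set \<Rightarrow> 'i::wellorder \<Rightarrow> 'a set" where
  "poset_seq R P = wfrec {(x, y). x < y} (\<lambda>F \<alpha>.
      if (\<forall>\<beta>. \<not> \<beta> < \<alpha>) then minimals R P
      else if (\<exists>\<beta>. \<beta> < \<alpha> \<and> (\<forall>\<gamma>. \<gamma> < \<alpha> \<longrightarrow> \<gamma> \<le> \<beta>))
        then (let Pb = F (THE \<beta>. \<beta> < \<alpha> \<and> (\<forall>\<gamma>. \<gamma> < \<alpha> \<longrightarrow> \<gamma> \<le> \<beta>))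
              in Pb \<union> minimals R (P - Pb))
      else \<Union> (F ` {\<beta>. \<beta> < \<alpha>}))"

definition poset_bar :: "('a \<Rightarrow> 'a \<Rightarrow> bool) \<Rightarrow> 'a set \<Rightarrow> 'i::wellorder \<Rightarrow> 'a set" where
  "poset_bar R P \<alpha> = P - poset_seq R P \<alpha>"

definition is_poset_CB_rank :: "('a \<Rightarrow> 'a \<Rightarrow> bool) \<Rightarrow> 'a set \<Rightarrow> 'i::wellorder \<Rightarrow> bool" where
  "is_poset_CB_rank R P \<alpha> \<longleftrightarrow>
     (let nxt = (\<lambda>\<beta>. P - (poset_seq R P \<beta> \<union> minimals R (poset_bar R P \<beta>))) in
       poset_bar R P \<alpha> = nxt \<alpha> \<and> (\<forall>\<beta>. \<beta> < \<alpha> \<longrightarrow> poset_bar R P \<beta> \<noteq> nxt \<beta>))"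

definition Q_set :: "(nat \<times> nat) set" where
  "Q_set = {(t, r). 1 \<le> t}"

definition Q_less :: "nat \<times> nat \<Rightarrow> nat \<times> nat \<Rightarrow> bool" where
  "Q_less = (\<lambda>(t', r') (t, r). t' dvd t \<and> t' * r' < t * r)"

end

theory Submission
  imports Defs "HOL-Library.Function_Algebras"
begin

text \<open>Both ranks are \<open>\<omega>\<close>, the least element of the index type with infinitely many predecessors
  (neither rank is attained if there is none).

  For \<open>\<Q>\<close>, stage k removes the pairs with \<open>t * r = k\<close>, because \<open>(1, k)\<close> lies below every pair
  with \<open>t * r > k\<close>.

  For the subgroups, write A for the lamp group. The subgroups of A form a perfect set, so they
  survive forever. Let H contain an element (h,T) with \<open>T > 0\<close>. Then \<open>M = H \<inter> A\<close> is invariant under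
  the shift by T; consider the finite set L of blocks of length T occurring at the top of elements
  of M. A subgroup K agreeing with H on a suitable finite set has at least the top blocks of H, and
  if it has no more, then division with remainder shows that \<open>K \<inter> A\<close> equals M, and the identity
  \<open>f - T.f + s.h - h \<in> M\<close> for all (f,s) in K leaves finitely many possibilities for f modulo M,
  so that \<open>K = H\<close>. Hence the rank of H is at most the number of blocks not in L.

  Conversely, split the integers into residue classes mod t and let H consist of the (f,k) with t
  dividing k such that f is divisible by \<open>1 - x^e(r)\<close> on the class r. A class with \<open>e(r) = 0\<close>,
  where f has to vanish, is the limit of the conditions with \<open>e(r) \<rightarrow> \<infinity>\<close>, so the rank of H is at
  least the number of zeros of e.\<close>

subsection \<open>Transfinite iteration\<close>

text \<open>As \<open>g\<close> shrinks sets, its iterates decrease; their intersection is reached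
  at the first position with infinitely many predecessors, and \<open>fixp\<close> keeps the
  sequence there afterwards. The index type is an arbitrary wellorder, so a finite position is
  identified by its number of predecessors.\<close>

lemma transfinite_iterates:
  fixes s :: "'i::wellorder \<Rightarrow> 'a set" and g :: "'a set \<Rightarrow> 'a set"
  assumes zero: "\<And>\<alpha>. \<forall>\<beta>. \<not> \<beta> < \<alpha> \<Longrightarrow> s \<alpha> = S\<^sub>0"
    and succ: "\<And>\<alpha> \<beta>. \<beta> < \<alpha> \<Longrightarrow> \<forall>\<gamma><\<alpha>. \<gamma> \<le> \<beta> \<Longrightarrow> s \<alpha> = g (s \<beta>)"
    and lim: "\<And>\<alpha>. \<exists>\<beta>. \<beta> < \<alpha> \<Longrightarrow> \<nexists>\<beta>. \<beta> < \<alpha> \<and> (\<forall>\<gamma><\<alpha>. \<gamma> \<le> \<beta>) \<Longrightarrow> s \<alpha> = \<Inter> (s ` {..<\<alpha>})"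
    and sub: "\<And>S. g S \<subseteq> S"
    and fixp: "g (\<Inter>k. (g ^^ k) S\<^sub>0) = (\<Inter>k. (g ^^ k) S\<^sub>0)"
  shows "s \<alpha> = (if finite {..<\<alpha>} then (g ^^ card {..<\<alpha>}) S\<^sub>0 else (\<Inter>k. (g ^^ k) S\<^sub>0))"
proof (induction \<alpha> rule: less_induct)
  case (less \<alpha>)
  have dec: "(g ^^ k) S\<^sub>0 \<subseteq> (g ^^ m) S\<^sub>0" if "m \<le> k" for m k
    using that by (induction rule: dec_induct) (use sub in auto)
  consider (z) "\<forall>\<beta>. \<not> \<beta> < \<alpha>" | (s) \<beta> where "\<beta> < \<alpha>" "\<forall>\<gamma><\<alpha>. \<gamma> \<le> \<beta>"
    | (l) "\<exists>\<beta>. \<beta> < \<alpha>" "\<nexists>\<beta>. \<beta> < \<alpha> \<and> (\<forall>\<gamma><\<alpha>. \<gamma> \<le> \<beta>)" by blast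
  then show ?case
  proof cases
    case z
    then have e: "{..<\<alpha>} = {}" by auto
    show ?thesis unfolding e using zero[OF z] by simp
  next
    case s
    then have e: "{..<\<alpha>} = insert \<beta> {..<\<beta>}" by force
    show ?thesis unfolding e using succ[OF s] less[OF s(1)] fixp by simp
  next
    case l
    have inf: "infinite {..<\<alpha>}"
    proof
      assume f: "finite {..<\<alpha>}"
      then have "Max {..<\<alpha>} \<in> {..<\<alpha>}" using l(1) by (intro Max_in) auto
      then show False using l(2) f by (metis Max_ge lessThan_iff)
    qed
    have "(\<Inter>k. (g ^^ k) S\<^sub>0) \<subseteq> s \<beta>" if "\<beta> < \<alpha>" for \<beta>
      using less[OF that] by auto
    \<comment> \<open>Either an earlier position already carries the full intersection, or all
      earlier positions are finite. In the second case their predecessor counts are pairwise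
      distinct, hence unbounded, and some count is at least \<open>k\<close>.\<close>
    moreover have "\<exists>\<beta><\<alpha>. s \<beta> \<subseteq> (g ^^ k) S\<^sub>0" for k
    proof (cases "\<exists>\<beta><\<alpha>. infinite {..<\<beta>}")
      case True
      then obtain \<beta> where "\<beta> < \<alpha>" "infinite {..<\<beta>}" by blast
      with less[of \<beta>] show ?thesis by auto
    next
      case False
      have mono: "card {..<\<beta>} < card {..<\<gamma>}" if "\<beta> < \<gamma>" "\<gamma> < \<alpha>" for \<beta> \<gamma>
        using that False by (intro psubset_card_mono) auto
      have "inj_on (\<lambda>\<beta>. card {..<\<beta>}) {..<\<alpha>}"
        using mono by (metis (no_types, lifting) inj_onI lessThan_iff linorder_neqE less_irrefl_nat)
      with inf have "\<not> (\<lambda>\<beta>. card {..<\<beta>}) ` {..<\<alpha>} \<subseteq> {..<k}"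
        using finite_subset finite_imageD by blast
      then obtain \<beta> where "k \<le> card {..<\<beta>}" "\<beta> < \<alpha>"
        unfolding image_subset_iff by (metis lessThan_iff not_less)
      with less[of \<beta>] False dec show ?thesis by (intro exI[of _ \<beta>]) simp
    qed
    ultimately have "\<Inter> (s ` {..<\<alpha>}) = (\<Inter>k. (g ^^ k) S\<^sub>0)"
      unfolding set_eq_iff INT_iff by (meson lessThan_iff subsetD UNIV_I INT_iff)
    then show ?thesis using lim[OF l] inf by simp
  qed
qed

text \<open>\<open>strict\<close> excludes stationarity at finite positions and \<open>fixp\<close>
  forces it at all others. The right-hand side no longer mentions the sequence, so any two sequences
  treated in this way have the same rank.\<close>

lemma transfinite_rank_omega:
  fixes s :: "'i::wellorder \<Rightarrow> 'a set" and g :: "'a set \<Rightarrow> 'a set"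
  assumes "\<And>\<alpha>. \<forall>\<beta>. \<not> \<beta> < \<alpha> \<Longrightarrow> s \<alpha> = S\<^sub>0"
    and "\<And>\<alpha> \<beta>. \<beta> < \<alpha> \<Longrightarrow> \<forall>\<gamma><\<alpha>. \<gamma> \<le> \<beta> \<Longrightarrow> s \<alpha> = g (s \<beta>)"
    and "\<And>\<alpha>. \<exists>\<beta>. \<beta> < \<alpha> \<Longrightarrow> \<nexists>\<beta>. \<beta> < \<alpha> \<and> (\<forall>\<gamma><\<alpha>. \<gamma> \<le> \<beta>) \<Longrightarrow> s \<alpha> = \<Inter> (s ` {..<\<alpha>})"
    and "\<And>S. g S \<subseteq> S"
    and fixp: "g (\<Inter>k. (g ^^ k) S\<^sub>0) = (\<Inter>k. (g ^^ k) S\<^sub>0)"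
    and strict: "\<And>k. (g ^^ k) S\<^sub>0 \<noteq> g ((g ^^ k) S\<^sub>0)"
  shows "s \<alpha> = g (s \<alpha>) \<and> (\<forall>\<beta><\<alpha>. s \<beta> \<noteq> g (s \<beta>)) \<longleftrightarrow>
    infinite {..<\<alpha>} \<and> (\<forall>\<beta><\<alpha>. finite {..<\<beta>})"
proof -
  have "s \<beta> = g (s \<beta>) \<longleftrightarrow> infinite {..<\<beta>}" for \<beta>
    using transfinite_iterates[of s S\<^sub>0 g \<beta>, OF assms(1-5)] fixp strict by auto
  then show ?thesis by auto
qed

section \<open>Unfolding the two transfinite recursions\<close>

lemma the_pred:
  fixes \<alpha> \<beta> :: "'i::wellorder"
  assumes "\<beta> < \<alpha>" "\<forall>\<gamma><\<alpha>. \<gamma> \<le> \<beta>"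
  shows "(THE \<beta>. \<beta> < \<alpha> \<and> (\<forall>\<gamma>. \<gamma> < \<alpha> \<longrightarrow> \<gamma> \<le> \<beta>)) = \<beta>"
  using assms by (intro the_equality) (auto intro: antisym)

lemma CB_seq_zero: "\<forall>\<beta>. \<not> \<beta> < \<alpha> \<Longrightarrow> CB_seq X \<alpha> = topspace X"
  unfolding CB_seq_def by (subst wfrec[OF wf]) simp

lemma CB_seq_succ:
  assumes "\<beta> < \<alpha>" "\<forall>\<gamma><\<alpha>. \<gamma> \<le> \<beta>"
  shows "CB_seq X \<alpha> = CB_deriv X (CB_seq X \<beta>)"
proof -
  have e: "\<exists>\<beta>. \<beta> < \<alpha> \<and> (\<forall>\<gamma>. \<gamma> < \<alpha> \<longrightarrow> \<gamma> \<le> \<beta>)" and n: "\<not> (\<forall>\<beta>. \<not> \<beta> < \<alpha>)"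
    using assms by blast+
  show ?thesis unfolding CB_seq_def
    by (subst wfrec[OF wf])
      (simp only: if_not_P[OF n] if_P[OF e] the_pred[OF assms] cut_apply mem_Collect_eq case_prod_conv assms(1))
qed

lemma CB_seq_lim:
  assumes "\<exists>\<beta>. \<beta> < \<alpha>" "\<nexists>\<beta>. \<beta> < \<alpha> \<and> (\<forall>\<gamma><\<alpha>. \<gamma> \<le> \<beta>)"
  shows "CB_seq X \<alpha> = \<Inter> (CB_seq X ` {..<\<alpha>})"
proof -
  have n: "\<not> (\<forall>\<beta>. \<not> \<beta> < \<alpha>)" using assms by blast
  show ?thesis unfolding CB_seq_def
    by (subst wfrec[OF wf]) (simp only: if_not_P[OF n] if_not_P[OF assms(2)], auto simp: cut_apply)
qed

lemma is_CB_rank_omega: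
  fixes X :: "'a topology" and \<alpha> :: "'i::wellorder"
  assumes "CB_deriv X (\<Inter>k. (CB_deriv X ^^ k) (topspace X)) = (\<Inter>k. (CB_deriv X ^^ k) (topspace X))"
    and "\<And>k. (CB_deriv X ^^ k) (topspace X) \<noteq> CB_deriv X ((CB_deriv X ^^ k) (topspace X))"
  shows "is_CB_rank X \<alpha> \<longleftrightarrow> infinite {..<\<alpha>} \<and> (\<forall>\<beta><\<alpha>. finite {..<\<beta>})"
  unfolding is_CB_rank_def
  by (rule transfinite_rank_omega[OF CB_seq_zero CB_seq_succ CB_seq_lim _ assms])
    (auto simp: CB_deriv_def)

lemma poset_bar_zero: "\<forall>\<beta>. \<not> \<beta> < \<alpha> \<Longrightarrow> poset_bar R P \<alpha> = P - minimals R P"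
  unfolding poset_bar_def poset_seq_def by (subst wfrec[OF wf]) simp

lemma poset_bar_succ:
  assumes "\<beta> < \<alpha>" "\<forall>\<gamma><\<alpha>. \<gamma> \<le> \<beta>"
  shows "poset_bar R P \<alpha> = poset_bar R P \<beta> - minimals R (poset_bar R P \<beta>)"
proof -
  have e: "\<exists>\<beta>. \<beta> < \<alpha> \<and> (\<forall>\<gamma>. \<gamma> < \<alpha> \<longrightarrow> \<gamma> \<le> \<beta>)" and n: "\<not> (\<forall>\<beta>. \<not> \<beta> < \<alpha>)"
    using assms by blast+
  have "poset_seq R P \<alpha> = poset_seq R P \<beta> \<union> minimals R (P - poset_seq R P \<beta>)"
    unfolding poset_seq_def
    by (subst wfrec[OF wf])
      (simp only: if_not_P[OF n] if_P[OF e] the_pred[OF assms] cut_apply mem_Collect_eq case_prod_conv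
        assms(1) Let_def)
  then show ?thesis by (auto simp: poset_bar_def)
qed

lemma poset_bar_lim:
  assumes "\<exists>\<beta>. \<beta> < \<alpha>" "\<nexists>\<beta>. \<beta> < \<alpha> \<and> (\<forall>\<gamma><\<alpha>. \<gamma> \<le> \<beta>)"
  shows "poset_bar R P \<alpha> = \<Inter> (poset_bar R P ` {..<\<alpha>})"
proof -
  have n: "\<not> (\<forall>\<beta>. \<not> \<beta> < \<alpha>)" using assms by blast
  have "poset_seq R P \<alpha> = \<Union> (poset_seq R P ` {..<\<alpha>})"
    unfolding poset_seq_def
    by (subst wfrec[OF wf]) (simp only: if_not_P[OF n] if_not_P[OF assms(2)], auto simp: cut_apply)
  then show ?thesis using assms(1) by (auto simp: poset_bar_def)
qed

text \<open>Passing to the complements \<open>poset_bar\<close> turns the growing sequence into a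
  decreasing one. Position 0 already removes the minimal elements, so the iteration starts from
  \<open>g P\<close> and not from \<open>P\<close>.\<close>

lemma is_poset_CB_rank_omega:
  fixes R :: "'a \<Rightarrow> 'a \<Rightarrow> bool" and P :: "'a set" and \<alpha> :: "'i::wellorder"
  defines "g \<equiv> \<lambda>S. S - minimals R S"
  assumes "g (\<Inter>k. (g ^^ k) (g P)) = (\<Inter>k. (g ^^ k) (g P))"
    and "\<And>k. (g ^^ k) (g P) \<noteq> g ((g ^^ k) (g P))"
  shows "is_poset_CB_rank R P \<alpha> \<longleftrightarrow> infinite {..<\<alpha>} \<and> (\<forall>\<beta><\<alpha>. finite {..<\<beta>})"
proof -
  have nxt: "P - (poset_seq R P \<beta> \<union> minimals R (poset_bar R P \<beta>)) = g (poset_bar R P \<beta>)"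
    for \<beta> :: 'i by (auto simp: g_def poset_bar_def)
  show ?thesis unfolding is_poset_CB_rank_def Let_def nxt
    by (rule transfinite_rank_omega[OF _ _ poset_bar_lim _ assms(2,3)])
      (auto simp: g_def poset_bar_zero poset_bar_succ)
qed

section \<open>The rank of the poset of pairs\<close>

lemma is_poset_CB_rank_Q:
  fixes \<alpha> :: "'i::wellorder"
  shows "is_poset_CB_rank Q_less Q_set \<alpha> \<longleftrightarrow> infinite {..<\<alpha>} \<and> (\<forall>\<beta><\<alpha>. finite {..<\<beta>})"
proof -
  define g where "g = (\<lambda>S. S - minimals Q_less S)"
  define Q where "Q k = {(t, r). 1 \<le> t \<and> k \<le> t * r}" for k :: nat
  have g_Q: "g (Q k) = Q (Suc k)" for k
  proof -
    have "(1, k) \<in> Q k" "Q_less (1, k) (t, r)" if "k < t * r" for t r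
      using that by (auto simp: Q_def Q_less_def)
    then show ?thesis unfolding g_def minimals_def
      by (fastforce simp: Q_def Q_less_def not_less)
  qed
  have Q0: "Q_set = Q 0" by (auto simp: Q_def Q_set_def)
  \<comment> \<open>The index is shifted by one because the starting set \<open>g Q_set\<close> is
    already \<open>Q 1\<close>.\<close>
  have it: "(g ^^ k) (g Q_set) = Q (Suc k)" for k
    unfolding Q0 by (induction k) (simp_all add: g_Q)
  have ne: "Q k \<noteq> Q (Suc k)" for k
  proof -
    have "(1, k) \<in> Q k - Q (Suc k)" by (simp add: Q_def)
    then show ?thesis by blast
  qed
  have "(t, r) \<notin> Q (Suc (t * r))" for t r by (simp add: Q_def)
  then have empty: "(\<Inter>k. Q (Suc k)) = {}" by fastforce
  have g: "S - minimals Q_less S = g S" for S by (simp add: g_def)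
  have "g {} = {}" by (simp add: g_def)
  with ne show ?thesis
    by (intro is_poset_CB_rank_omega; unfold g g_def[symmetric]) (simp_all add: it g_Q empty)
qed

subsection \<open>The derivative on spaces of subgroups\<close>

text \<open>The Cantor-Bendixson derivative in combinatorial form: the subgroups agreeing with
  \<open>H\<close> on a finite set form a basic neighbourhood of \<open>H\<close>, so
  \<open>H\<close> is isolated when finitely many membership conditions single it out.\<close>

definition sub_deriv :: "'a set set \<Rightarrow> 'a set set" where
  "sub_deriv \<S> = {H \<in> \<S>. \<forall>F. finite F \<longrightarrow> (\<exists>K \<in> \<S>. K \<noteq> H \<and> K \<inter> F = H \<inter> F)}"

definition sub_point :: "('a, 'b) monoid_scheme \<Rightarrow> 'a set \<Rightarrow> 'a \<Rightarrow> bool" where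
  "sub_point G H = restrict (\<lambda>g. g \<in> H) (carrier G)"

lemma topspace_Sub_space: "topspace (Sub_space G) = sub_point G ` {H. subgroup H G}"
  by (auto simp: Sub_space_def sub_point_def)

lemma inj_on_sub_point: "inj_on (sub_point G) {H. subgroup H G}"
proof (intro inj_onI, clarsimp)
  fix H K assume H: "subgroup H G" "subgroup K G" and e: "sub_point G H = sub_point G K"
  have "x \<in> H \<longleftrightarrow> x \<in> K" if "x \<in> carrier G" for x
    using fun_cong[OF e, of x] that by (simp add: sub_point_def)
  then show "H = K" using H subgroup.subset by blast
qed

text \<open>A basic open box of the product restricts finitely many coordinates, and conversely
  finitely many membership conditions define such a box. Limit points are computed in the full
  product; passing to the subspace only intersects them with the set of subgroups.\<close>

lemma CB_deriv_Sub_space: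
  assumes S: "\<S> \<subseteq> {H. subgroup H G}"
  shows "CB_deriv (Sub_space G) (sub_point G ` \<S>) = sub_point G ` sub_deriv \<S>"
proof -
  define C where "C = carrier G"
  define P where "P = product_topology (\<lambda>_. discrete_topology (UNIV :: bool set)) C"
  have sb: "H \<subseteq> C" if "H \<in> \<S>" for H using that S subgroup.subset by (auto simp: C_def)
  have pt: "sub_point G K x \<longleftrightarrow> x \<in> K" if "x \<in> C" for K x using that by (simp add: sub_point_def C_def)
  have ext: "sub_point G K \<in> Pi\<^sub>E C (\<lambda>_. UNIV)" for K by (simp add: sub_point_def C_def)
  have eq: "sub_point G K = sub_point G H \<longleftrightarrow> K = H" if "K \<in> \<S>" "H \<in> \<S>" for K H
    by (rule inj_on_eq_iff[OF inj_on_sub_point]) (use that S in auto)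
  have lp: "sub_point G H \<in> P derived_set_of (sub_point G ` \<S>) \<longleftrightarrow> H \<in> sub_deriv \<S>" if H: "H \<in> \<S>" for H
  proof
    assume a: "sub_point G H \<in> P derived_set_of (sub_point G ` \<S>)"
    have "\<exists>K\<in>\<S>. K \<noteq> H \<and> K \<inter> F = H \<inter> F" if "finite F" for F
    proof -
      define U where "U = Pi\<^sub>E C (\<lambda>x. if x \<in> F then {x \<in> H} else UNIV)"
      have "finite {x \<in> C. (if x \<in> F then {x \<in> H} else UNIV) \<noteq> UNIV}"
        by (rule finite_subset[OF _ that]) (simp add: subset_iff)
      then have "openin P U" unfolding U_def P_def by (subst openin_PiE_gen) auto
      moreover have "sub_point G H \<in> U" using ext[of H] by (auto simp: U_def PiE_iff pt)
      ultimately obtain K where K: "K \<in> \<S>" "sub_point G K \<noteq> sub_point G H" and U: "sub_point G K \<in> U"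
        using a unfolding in_derived_set_of by blast
      have "x \<in> K \<longleftrightarrow> x \<in> H" if "x \<in> C" "x \<in> F" for x
        using PiE_mem[OF U[unfolded U_def] that(1)] that by (simp add: pt)
      then have "K \<inter> F = H \<inter> F" using sb[OF H] sb[OF K(1)] by blast
      then show ?thesis using K by auto
    qed
    then show "H \<in> sub_deriv \<S>" using H by (simp add: sub_deriv_def)
  next
    assume a: "H \<in> sub_deriv \<S>"
    show "sub_point G H \<in> P derived_set_of (sub_point G ` \<S>)"
      unfolding in_derived_set_of
    proof (intro conjI allI impI)
      show "sub_point G H \<in> topspace P" using ext by (simp add: P_def)
      fix U assume "sub_point G H \<in> U \<and> openin P U"
      then obtain V where V: "finite {x \<in> C. V x \<noteq> UNIV}" "sub_point G H \<in> Pi\<^sub>E C V" "Pi\<^sub>E C V \<subseteq> U"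
        unfolding P_def openin_product_topology_alt by auto
      define F where "F = {x \<in> C. V x \<noteq> UNIV}"
      have "\<forall>F. finite F \<longrightarrow> (\<exists>K\<in>\<S>. K \<noteq> H \<and> K \<inter> F = H \<inter> F)"
        using a by (simp add: sub_deriv_def)
      then obtain K where K: "K \<in> \<S>" "K \<noteq> H" "K \<inter> F = H \<inter> F"
        using V(1) unfolding F_def by meson
      have "sub_point G K x \<in> V x" if x: "x \<in> C" for x
      proof (cases "x \<in> F")
        case True
        then have "sub_point G K x = sub_point G H x" using K(3) pt[OF x] by blast
        then show ?thesis using PiE_mem[OF V(2) x] by simp
      qed (use x in \<open>simp add: F_def\<close>)
      then have "sub_point G K \<in> Pi\<^sub>E C V" using ext[of K] by (simp add: PiE_iff)
      then have "sub_point G K \<in> U" using V(3) by (rule subsetD[rotated])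
      then show "\<exists>y. y \<noteq> sub_point G H \<and> y \<in> sub_point G ` \<S> \<and> y \<in> U"
        using K(1,2) eq[OF K(1) H] by (intro exI[of _ "sub_point G K"]) simp
    qed
  qed
  have "sub_point G ` {H. subgroup H G} \<inter> sub_point G ` \<S> = sub_point G ` \<S>" using S by blast
  then have "Sub_space G derived_set_of (sub_point G ` \<S>) =
      sub_point G ` {H. subgroup H G} \<inter> P derived_set_of (sub_point G ` \<S>)"
    by (simp add: Sub_space_def derived_set_of_subtopology P_def C_def sub_point_def[abs_def])
  moreover have "sub_deriv \<S> \<subseteq> \<S>" by (auto simp: sub_deriv_def)
  moreover have "sub_point G ` \<S> \<inter> P derived_set_of (sub_point G ` \<S>) = sub_point G ` sub_deriv \<S>"
    using lp \<open>sub_deriv \<S> \<subseteq> \<S>\<close> by auto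
  ultimately show ?thesis
    using S unfolding CB_deriv_def by auto
qed

text \<open>Moves the computation from topology to families of subgroups. Injectivity of
  \<open>sub_point\<close> makes images commute with the intersection of the stages and preserves
  strictness.\<close>

lemma is_CB_rank_Sub_space_omega:
  fixes G :: "('a, 'b) monoid_scheme" and \<alpha> :: "'i::wellorder"
  defines "D \<equiv> \<lambda>k. (sub_deriv ^^ k) {H. subgroup H G}"
  assumes "sub_deriv (\<Inter>k. D k) = (\<Inter>k. D k)" and "\<And>k. D k \<noteq> D (Suc k)"
  shows "is_CB_rank (Sub_space G) \<alpha> \<longleftrightarrow> infinite {..<\<alpha>} \<and> (\<forall>\<beta><\<alpha>. finite {..<\<beta>})"
proof -
  define X where "X = Sub_space G"
  have D0: "D k \<subseteq> {H. subgroup H G}" for k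
    by (induction k) (auto simp: D_def sub_deriv_def)
  have suc: "CB_deriv X (sub_point G ` D k) = sub_point G ` D (Suc k)" for k
    using CB_deriv_Sub_space[OF D0] by (simp add: X_def D_def)
  have it: "(CB_deriv X ^^ k) (topspace X) = sub_point G ` D k" for k
  proof (induction k)
    case 0
    show ?case by (simp add: X_def D_def topspace_Sub_space)
  next
    case (Suc k)
    then show ?case using suc by simp
  qed
  have int: "(\<Inter>k. sub_point G ` D k) = sub_point G ` (\<Inter>k. D k)"
    by (rule image_INT[OF inj_on_sub_point, symmetric]) (use D0 in auto)
  have sub: "(\<Inter>k. D k) \<subseteq> {H. subgroup H G}" using D0[of 0] by auto
  have ne: "sub_point G ` D k \<noteq> sub_point G ` D (Suc k)" for k
    using inj_on_image_eq_iff[OF inj_on_sub_point D0 D0] assms(3) by simp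
  have "CB_deriv X (\<Inter>k. (CB_deriv X ^^ k) (topspace X)) = (\<Inter>k. (CB_deriv X ^^ k) (topspace X))"
    unfolding it int using CB_deriv_Sub_space[OF sub] assms(2) by (simp add: X_def)
  moreover have "(CB_deriv X ^^ k) (topspace X) \<noteq> CB_deriv X ((CB_deriv X ^^ k) (topspace X))" for k
    unfolding it suc by (rule ne)
  ultimately show ?thesis unfolding X_def by (rule is_CB_rank_omega)
qed

subsection \<open>The lamplighter group\<close>

locale lamp =
  fixes n p :: nat
  assumes p2: "2 \<le> p" and n1: "1 \<le> n"
begin

abbreviation G where "G \<equiv> lamplighter n p"

abbreviation red :: "(int \<Rightarrow> nat \<Rightarrow> int) \<Rightarrow> int \<Rightarrow> nat \<Rightarrow> int" where
  "red f \<equiv> \<lambda>i j. f i j mod int p"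

definition shift :: "int \<Rightarrow> (int \<Rightarrow> nat \<Rightarrow> int) \<Rightarrow> int \<Rightarrow> nat \<Rightarrow> int" where
  "shift k f = (\<lambda>i. f (i - k))"

text \<open>Subgroups are handled through their preimages under reduction mod p, so that lamp
  configurations form an honest additive group of integer-valued functions.\<close>

definition lamps :: "(int \<Rightarrow> nat \<Rightarrow> int) set" where
  "lamps = {f. (\<forall>i j. n \<le> j \<longrightarrow> int p dvd f i j) \<and> finite {i. \<exists>j. \<not> int p dvd f i j}}"

definition lift :: "((int \<Rightarrow> nat \<Rightarrow> int) \<times> int) set \<Rightarrow> ((int \<Rightarrow> nat \<Rightarrow> int) \<times> int) set" where
  "lift H = {(f, k). (red f, k) \<in> H}"

definition supp_within :: "int \<Rightarrow> int \<Rightarrow> (int \<Rightarrow> nat \<Rightarrow> int) \<Rightarrow> bool" where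
  "supp_within a b f \<longleftrightarrow> (\<forall>i j. i < a \<or> b \<le> i \<longrightarrow> int p dvd f i j)"

lemma p_pos: "0 < int p" using p2 by simp

lemma shift_simps [simp]:
  "shift k (f + g) = shift k f + shift k g" "shift k (f - g) = shift k f - shift k g"
  "shift k (- f) = - shift k f" "shift k 0 = 0" "shift k (shift l f) = shift (k + l) f"
  "shift 0 f = f"
  by (simp_all only: shift_def fun_eq_iff plus_fun_apply minus_apply uminus_apply zero_fun_apply)
    (simp_all add: diff_diff_eq)

lemma shift_apply: "shift k f i = f (i - k)"
  by (simp add: shift_def)

lemma red_eq_iff: "red f = red g \<longleftrightarrow> (\<forall>i j. int p dvd f i j - g i j)"
  by (auto simp: fun_eq_iff mod_eq_dvd_iff)

lemma red_in_carrier_iff: "(red f, k) \<in> carrier G \<longleftrightarrow> f \<in> lamps"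
  using p_pos by (auto simp: lamplighter_def lamp_carrier_def lamps_def dvd_eq_mod_eq_0)

lemma carrier_red: "(f, k) \<in> carrier G \<Longrightarrow> red f = f"
  by (auto simp: lamplighter_def lamp_carrier_def fun_eq_iff)

lemma carrier_lamps: "(f, k) \<in> carrier G \<Longrightarrow> f \<in> lamps"
  using carrier_red red_in_carrier_iff by metis

lemma lamps_cong: "f \<in> lamps \<Longrightarrow> red f = red g \<Longrightarrow> g \<in> lamps"
  by (metis red_in_carrier_iff)

lemma lamps_zero: "0 \<in> lamps" by (simp add: lamps_def)

lemma lamps_add:
  assumes "f \<in> lamps" "g \<in> lamps" shows "f + g \<in> lamps"
proof -
  have "{i. \<exists>j. \<not> int p dvd (f + g) i j} \<subseteq>
      {i. \<exists>j. \<not> int p dvd f i j} \<union> {i. \<exists>j. \<not> int p dvd g i j}"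
    by (auto intro: dvd_add)
  then have "finite {i. \<exists>j. \<not> int p dvd (f + g) i j}"
    by (rule finite_subset) (use assms in \<open>simp add: lamps_def\<close>)
  then show ?thesis using assms by (auto simp: lamps_def)
qed

lemma lamps_uminus: "f \<in> lamps \<Longrightarrow> - f \<in> lamps"
  by (simp add: lamps_def)

lemma lamps_diff: "f \<in> lamps \<Longrightarrow> g \<in> lamps \<Longrightarrow> f - g \<in> lamps"
  using lamps_add lamps_uminus by (metis diff_conv_add_uminus)

lemma lamps_shift:
  assumes "f \<in> lamps" shows "shift k f \<in> lamps"
proof -
  have "{i. \<exists>j. \<not> int p dvd f (i - k) j} \<subseteq> (\<lambda>i. i + k) ` {i. \<exists>j. \<not> int p dvd f i j}"
    by (auto intro!: image_eqI[of _ _ "_ - k"])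
  then have "finite {i. \<exists>j. \<not> int p dvd f (i - k) j}"
    by (rule finite_subset) (use assms in \<open>simp add: lamps_def\<close>)
  then show ?thesis using assms by (auto simp: lamps_def shift_def)
qed

lemma mult_G: "(f, k) \<otimes>\<^bsub>G\<^esub> (g, l) = (red (f + shift k g), k + l)"
  by (simp add: lamplighter_def shift_def)

lemma one_G: "\<one>\<^bsub>G\<^esub> = (0, 0)"
  by (simp add: lamplighter_def zero_fun_def)

lemma mult_red: "(red f, k) \<otimes>\<^bsub>G\<^esub> (red g, l) = (red (f + shift k g), k + l)"
  by (simp add: mult_G shift_def mod_simps)

lemma carrier_cases:
  assumes "x \<in> carrier G" obtains f k where "x = (red f, k)" "f \<in> lamps"
proof -
  obtain f k where x: "x = (f, k)" by force
  show thesis by (rule that[of f k]) (use assms x carrier_red[of f k] carrier_lamps in auto)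
qed

lemma red_zero: "red 0 = 0" by (simp add: fun_eq_iff)

lemma group_G: "group G"
proof (rule groupI)
  fix x y assume "x \<in> carrier G" "y \<in> carrier G"
  then obtain f k g l where "x = (red f, k)" "f \<in> lamps" "y = (red g, l)" "g \<in> lamps"
    by (metis carrier_cases)
  then show "x \<otimes>\<^bsub>G\<^esub> y \<in> carrier G"
    by (simp only: mult_red red_in_carrier_iff lamps_add lamps_shift)
next
  show "\<one>\<^bsub>G\<^esub> \<in> carrier G"
    using red_in_carrier_iff[of 0 0] lamps_zero by (simp only: one_G red_zero)
next
  fix x y z assume "x \<in> carrier G" "y \<in> carrier G" "z \<in> carrier G"
  then obtain f k g l h m where x: "x = (red f, k)" and y: "y = (red g, l)" and z: "z = (red h, m)"
    by (metis carrier_cases)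
  show "x \<otimes>\<^bsub>G\<^esub> y \<otimes>\<^bsub>G\<^esub> z = x \<otimes>\<^bsub>G\<^esub> (y \<otimes>\<^bsub>G\<^esub> z)"
    by (simp only: x y z mult_red shift_simps add.assoc)
next
  fix x assume "x \<in> carrier G"
  then obtain f k where x: "x = (red f, k)" "f \<in> lamps" by (metis carrier_cases)
  show "\<one>\<^bsub>G\<^esub> \<otimes>\<^bsub>G\<^esub> x = x"
    using mult_red[of 0 0 f k] by (simp only: x(1) one_G red_zero) simp
  have "(red (shift (- k) (- f)), - k) \<otimes>\<^bsub>G\<^esub> x = \<one>\<^bsub>G\<^esub>"
    by (simp only: x one_G mult_red shift_simps) (simp add: red_zero fun_eq_iff)
  then show "\<exists>y\<in>carrier G. y \<otimes>\<^bsub>G\<^esub> x = \<one>\<^bsub>G\<^esub>"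
    using red_in_carrier_iff lamps_shift lamps_uminus x(2) by blast
qed

lemma inv_red:
  assumes "f \<in> lamps"
  shows "inv\<^bsub>G\<^esub> (red f, k) = (red (- shift (- k) f), - k)"
proof (rule group.inv_equality[OF group_G])
  show "(red (- shift (- k) f), - k) \<otimes>\<^bsub>G\<^esub> (red f, k) = \<one>\<^bsub>G\<^esub>"
    by (simp only: one_G mult_red shift_simps) (simp add: red_zero fun_eq_iff)
qed (simp_all only: red_in_carrier_iff assms lamps_shift lamps_uminus)

context
  fixes H assumes H: "subgroup H G"
begin

lemma lift_lamps: "(f, k) \<in> lift H \<Longrightarrow> f \<in> lamps"
  using subgroup.subset[OF H] red_in_carrier_iff[of f k] by (auto simp: lift_def)

lemma lift_mult: "(f, k) \<in> lift H \<Longrightarrow> (g, l) \<in> lift H \<Longrightarrow> (f + shift k g, k + l) \<in> lift H"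
  unfolding lift_def mem_Collect_eq case_prod_conv mult_red[symmetric]
  by (rule subgroup.m_closed[OF H])

lemma lift_inv: "(f, k) \<in> lift H \<Longrightarrow> (- shift (- k) f, - k) \<in> lift H"
  using subgroup.m_inv_closed[OF H, of "(red f, k)"] inv_red[OF lift_lamps]
  by (simp only: lift_def mem_Collect_eq case_prod_conv)

lemma lift_zero: "(0, 0) \<in> lift H"
  using subgroup.one_closed[OF H] unfolding lift_def mem_Collect_eq case_prod_conv red_zero one_G .

lemma subgroup_subset_iff: "H \<subseteq> K \<longleftrightarrow> lift H \<subseteq> lift K"
proof
  assume le: "lift H \<subseteq> lift K"
  show "H \<subseteq> K"
  proof
    fix x assume x: "x \<in> H"
    then obtain f k where f: "x = (red f, k)" using subgroup.subset[OF H] carrier_cases by (meson subsetD)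
    then have "(f, k) \<in> lift H" using x by (simp add: lift_def)
    then have "(f, k) \<in> lift K" using le by blast
    then show "x \<in> K" using f by (simp add: lift_def)
  qed
qed (auto simp: lift_def)

end

lemma lift_cong: "(f, k) \<in> lift H \<Longrightarrow> red f = red g \<Longrightarrow> (g, k) \<in> lift H"
  unfolding lift_def mem_Collect_eq case_prod_conv by simp

text \<open>Closure can thus be checked on integer-valued representatives. The last assumption makes
  \<open>S\<close> a union of congruence classes, so membership does not depend on the
  representative chosen.\<close>

lemma subgroupI_lift:
  assumes S: "(0, 0) \<in> S"
    and "\<And>f k g l. (f, k) \<in> S \<Longrightarrow> (g, l) \<in> S \<Longrightarrow> (f + shift k g, k + l) \<in> S"
    and "\<And>f k. (f, k) \<in> S \<Longrightarrow> (- shift (- k) f, - k) \<in> S"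
    and cong: "\<And>f g k. (f, k) \<in> S \<Longrightarrow> red f = red g \<Longrightarrow> (g, k) \<in> S"
  shows "subgroup (S \<inter> carrier G) G"
proof (rule group.subgroupI[OF group_G])
  have red: "(red f, k) \<in> S \<longleftrightarrow> (f, k) \<in> S" for f k
    by (rule iffI) (erule cong, simp)+
  show "S \<inter> carrier G \<noteq> {}"
    using S one_G monoid.one_closed[OF group.is_monoid[OF group_G]] by (metis IntI empty_iff)
  fix x assume x: "x \<in> S \<inter> carrier G"
  obtain f k where f: "x = (red f, k)" "f \<in> lamps" by (metis x IntD2 carrier_cases)
  have "(f, k) \<in> S" using x f(1) red by simp
  then have "inv\<^bsub>G\<^esub> x \<in> S" unfolding f(1) inv_red[OF f(2)] red by (rule assms(3))
  then show "inv\<^bsub>G\<^esub> x \<in> S \<inter> carrier G" using x group.inv_closed[OF group_G] by auto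
  fix y assume y: "y \<in> S \<inter> carrier G"
  obtain g l where g: "y = (red g, l)" by (metis y IntD2 carrier_cases)
  have "(g, l) \<in> S" using y g red by simp
  then have "x \<otimes>\<^bsub>G\<^esub> y \<in> S" unfolding f(1) g mult_red red using \<open>(f, k) \<in> S\<close> by (intro assms(2))
  then show "x \<otimes>\<^bsub>G\<^esub> y \<in> S \<inter> carrier G"
    using x y monoid.m_closed[OF group.is_monoid[OF group_G]] by auto
qed auto

section \<open>Supports and finite windows\<close>

lemma lamps_supp_within:
  assumes "f \<in> lamps" obtains B :: nat where "supp_within (- int B) (int B) f"
proof -
  let ?S = "{i. \<exists>j. \<not> int p dvd f i j}"
  have "finite ((\<lambda>i. nat \<bar>i\<bar>) ` ?S)" using assms by (simp add: lamps_def)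
  then obtain B where "\<forall>x\<in>(\<lambda>i. nat \<bar>i\<bar>) ` ?S. x < B"
    using finite_nat_set_iff_bounded by blast
  then have B: "int p dvd f i j" if "\<not> nat \<bar>i\<bar> < B" for i j using that by blast
  show thesis by (rule that[of B]) (auto simp: supp_within_def intro!: B)
qed

lemma supp_within_mono: "supp_within a b f \<Longrightarrow> c \<le> a \<Longrightarrow> b \<le> d \<Longrightarrow> supp_within c d f"
  by (auto simp: supp_within_def)

lemma supp_within_shift: "supp_within a b f \<Longrightarrow> supp_within (a + k) (b + k) (shift k f)"
  by (auto simp: supp_within_def shift_apply)

lemma supp_within_cong: "supp_within a b f \<Longrightarrow> red f = red g \<Longrightarrow> supp_within a b g"
  unfolding supp_within_def dvd_eq_mod_eq_0 by (metis (no_types, lifting))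

text \<open>Taking reductions makes the set finite, since every congruence class of integer-valued
  configurations is infinite.\<close>

definition window :: "int \<Rightarrow> int \<Rightarrow> (int \<Rightarrow> nat \<Rightarrow> int) set" where
  "window a b = red ` {f \<in> lamps. supp_within a b f}"

lemma finite_window: "finite (window a b)"
proof -
  define R where "R = {r. \<forall>j. (j \<in> {..<n} \<longrightarrow> r j \<in> {0..<int p}) \<and> (j \<notin> {..<n} \<longrightarrow> r j = (0::int))}"
  define W where "W = {f. \<forall>i. (i \<in> {a..<b} \<longrightarrow> f i \<in> R) \<and> (i \<notin> {a..<b} \<longrightarrow> f i = (\<lambda>_. 0))}"
  have "finite W" unfolding W_def R_def by (intro finite_set_of_finite_funs) auto
  moreover have "window a b \<subseteq> W"
    using p_pos by (auto simp: window_def W_def R_def lamps_def supp_within_def fun_eq_iff)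
  ultimately show ?thesis by (rule rev_finite_subset)
qed

lemma windowI: "f \<in> lamps \<Longrightarrow> supp_within a b f \<Longrightarrow> red f \<in> window a b"
  unfolding window_def by blast

lemma finite_bounded_supp:
  assumes "finite S" "S \<subseteq> lamps"
  obtains B :: nat where "\<And>f. f \<in> S \<Longrightarrow> supp_within (- int B) (int B) f"
proof -
  have "\<exists>B::nat. \<forall>f\<in>S. supp_within (- int B) (int B) f"
    using assms
  proof (induction rule: finite_induct)
    case (insert f S)
    then obtain B where B: "\<forall>f\<in>S. supp_within (- int B) (int B) f" by auto
    have "f \<in> lamps" using insert.prems by simp
    then obtain C where C: "supp_within (- int C) (int C) f" by (rule lamps_supp_within)
    show ?case
    proof (intro exI ballI)
      fix g assume "g \<in> insert f S"
      then show "supp_within (- int (max B C)) (int (max B C)) g"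
        using B supp_within_mono[OF C, of "- int (max B C)" "int (max B C)"]
          supp_within_mono[of "- int B" "int B" g "- int (max B C)" "int (max B C)"] by auto
    qed
  qed simp
  then show thesis using that by blast
qed

subsection \<open>Subgroups of the lamp group\<close>

lemma carrier_mem_iff_lift: "(f, k) \<in> carrier G \<Longrightarrow> (f, k) \<in> H \<longleftrightarrow> (f, k) \<in> lift H"
  using carrier_red[of f k] by (simp add: lift_def)

text \<open>This family turns out to be the perfect kernel: \<open>sub_deriv\<close> fixes it, and
  it is what remains after all finite stages.\<close>

definition base_subgroups :: "((int \<Rightarrow> nat \<Rightarrow> int) \<times> int) set set" where
  "base_subgroups = {H. subgroup H G \<and> (\<forall>f k. (f, k) \<in> H \<longrightarrow> k = 0)}"

lemma finite_carrier_bound: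
  assumes "finite F"
  obtains B :: nat where "\<And>f k. (f, k) \<in> F \<Longrightarrow> (f, k) \<in> carrier G \<Longrightarrow> supp_within (- int B) (int B) f"
proof -
  have "finite (fst ` (F \<inter> carrier G))" "fst ` (F \<inter> carrier G) \<subseteq> lamps"
    using assms carrier_lamps by auto
  then obtain B :: nat where B: "\<And>f. f \<in> fst ` (F \<inter> carrier G) \<Longrightarrow> supp_within (- int B) (int B) f"
    by (rule finite_bounded_supp) blast
  show thesis by (rule that[of B], rule B) force
qed

definition spike :: "int \<Rightarrow> int \<Rightarrow> nat \<Rightarrow> int" where
  "spike m = (\<lambda>i j. if i = m \<and> j = 0 then 1 else 0)"

lemma spike_lamps: "spike m \<in> lamps"
proof -
  have "{i. \<exists>j. \<not> int p dvd spike m i j} \<subseteq> {m}" by (auto simp: spike_def)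
  then have "finite {i. \<exists>j. \<not> int p dvd spike m i j}" by (rule finite_subset) simp
  then show ?thesis using n1 by (auto simp: lamps_def spike_def)
qed

lemma not_p_dvd_1: "\<not> int p dvd 1" using p2 by auto

text \<open>Closure holds because all elements have position 0, so that products add configurations
  without moving their supports.\<close>

lemma base_truncate:
  assumes V: "V \<in> base_subgroups"
  shows "V \<inter> {(f, k). supp_within a b f} \<in> base_subgroups"
proof -
  have H: "subgroup V G" and z: "\<And>f k. (f, k) \<in> V \<Longrightarrow> k = 0" using V by (auto simp: base_subgroups_def)
  have z': "k = 0" if "(f, k) \<in> lift V" for f k using that z by (auto simp: lift_def)
  define S where "S = {(f, k). (f, k) \<in> lift V \<and> supp_within a b f}"
  have "subgroup (S \<inter> carrier G) G"
  proof (rule subgroupI_lift)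
    show "(0, 0) \<in> S" using lift_zero[OF H] by (simp add: S_def supp_within_def)
    show "(f + shift k g, k + l) \<in> S" if "(f, k) \<in> S" "(g, l) \<in> S" for f k g l
      using that lift_mult[OF H, of f k g l] z'[of f k]
      by (auto simp: S_def supp_within_def)
    show "(- shift (- k) f, - k) \<in> S" if "(f, k) \<in> S" for f k
      using that lift_inv[OF H, of f k] z'[of f k] by (auto simp: S_def supp_within_def)
    show "(g, k) \<in> S" if "(f, k) \<in> S" "red f = red g" for f g k
    proof -
      have "(f, k) \<in> lift V" "supp_within a b f" using that(1) by (simp_all add: S_def)
      then show ?thesis
        using lift_cong[OF _ that(2)] supp_within_cong[OF _ that(2)] by (simp add: S_def)
    qed
  qed
  moreover have "S \<inter> carrier G = V \<inter> {(f, k). supp_within a b f}"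
    using carrier_mem_iff_lift subgroup.subset[OF H] by (auto simp: S_def)
  ultimately show ?thesis using z by (auto simp: base_subgroups_def)
qed

text \<open>This is the preimage of \<open>V\<close> under the endomorphism of the lamp group that
  clears position \<open>m\<close>. It contains every lamp at \<open>m\<close> and agrees with
  \<open>V\<close> on configurations vanishing there.\<close>

lemma base_enlarge:
  assumes V: "V \<in> base_subgroups"
  shows "{(f, k) \<in> carrier G. (f(m := 0), k) \<in> lift V} \<in> base_subgroups"
proof -
  have H: "subgroup V G" and z: "\<And>f k. (f, k) \<in> V \<Longrightarrow> k = 0" using V by (auto simp: base_subgroups_def)
  have z': "k = 0" if "(f, k) \<in> lift V" for f k using that z by (auto simp: lift_def)
  define S where "S = {(f, k). (f(m := 0), k) \<in> lift V}"
  have upd: "(f + g)(m := 0) = f(m := 0) + g(m := 0)" "(- f)(m := 0) = - (f(m := 0))"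
    for f g :: "int \<Rightarrow> nat \<Rightarrow> int" by (auto simp: fun_eq_iff)
  have "subgroup (S \<inter> carrier G) G"
  proof (rule subgroupI_lift)
    have "0(m := 0) = (0 :: int \<Rightarrow> nat \<Rightarrow> int)" by (auto simp: fun_eq_iff)
    then show "(0, 0) \<in> S" using lift_zero[OF H] by (simp add: S_def)
    show "(f + shift k g, k + l) \<in> S" if "(f, k) \<in> S" "(g, l) \<in> S" for f k g l
    proof -
      have f: "(f(m := 0), k) \<in> lift V" and g: "(g(m := 0), l) \<in> lift V" using that by (auto simp: S_def)
      from lift_mult[OF H this] z'[OF f] show ?thesis by (simp add: S_def upd)
    qed
    show "(- shift (- k) f, - k) \<in> S" if "(f, k) \<in> S" for f k
    proof -
      have f: "(f(m := 0), k) \<in> lift V" using that by (auto simp: S_def)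
      from lift_inv[OF H this] z'[OF f] show ?thesis by (simp add: S_def upd)
    qed
    show "(g, k) \<in> S" if "(f, k) \<in> S" "red f = red g" for f g k
    proof -
      have "(f(m := 0), k) \<in> lift V" using that(1) by (simp add: S_def)
      moreover have "red (f(m := 0)) = red (g(m := 0))"
        using that(2) unfolding red_eq_iff by simp
      ultimately show ?thesis using lift_cong by (simp add: S_def)
    qed
  qed
  moreover have "S \<inter> carrier G = {(f, k) \<in> carrier G. (f(m := 0), k) \<in> lift V}"
    by (auto simp: S_def)
  ultimately show ?thesis using z' by (auto simp: base_subgroups_def)
qed

text \<open>A subgroup of the lamp group is approximated by its elements supported in a large window;
  if it lies in that window, switch on all lamps at a position outside instead.\<close>

lemma sub_deriv_base: "sub_deriv base_subgroups = base_subgroups"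
proof
  show "sub_deriv base_subgroups \<subseteq> base_subgroups" by (auto simp: sub_deriv_def)
  show "base_subgroups \<subseteq> sub_deriv base_subgroups"
  proof
    fix V assume V: "V \<in> base_subgroups"
    then have H: "subgroup V G" by (simp add: base_subgroups_def)
    have "\<exists>K\<in>base_subgroups. K \<noteq> V \<and> K \<inter> F = V \<inter> F" if fin: "finite F" for F
    proof -
      obtain B :: nat where B: "\<And>f k. (f, k) \<in> F \<Longrightarrow> (f, k) \<in> carrier G \<Longrightarrow> supp_within (- int B) (int B) f"
        by (rule finite_carrier_bound[OF fin]) blast
      define K\<^sub>1 where "K\<^sub>1 = V \<inter> {(f, k). supp_within (- int B) (int B) f}"
      define K\<^sub>2 where "K\<^sub>2 = {(f, k) \<in> carrier G. (f(int B := 0), k) \<in> lift V}"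
      have sub: "V \<subseteq> carrier G" by (rule subgroup.subset[OF H])
      show ?thesis
      proof (cases "K\<^sub>1 = V")
        case False
        have "K\<^sub>1 \<inter> F = V \<inter> F" using B sub by (auto simp: K\<^sub>1_def)
        moreover have "K\<^sub>1 \<in> base_subgroups" unfolding K\<^sub>1_def by (rule base_truncate[OF V])
        ultimately show ?thesis using False by (intro bexI[of _ K\<^sub>1] conjI)
      next
        case True
        \<comment> \<open>The window is half-open, so \<open>B\<close> is the first position to its
          right. A lamp there belongs to \<open>K\<^sub>2\<close> but not to \<open>V\<close>, whose
          elements now all live in the window.\<close>
        have c: "(red (spike (int B)), 0) \<in> carrier G" by (simp only: red_in_carrier_iff spike_lamps)
        have "red ((red (spike (int B)))(int B := 0)) = red 0"
          by (auto simp: spike_def fun_eq_iff)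
        then have "(red (spike (int B)), 0) \<in> K\<^sub>2"
          using c lift_cong[OF lift_zero[OF H]] by (simp add: K\<^sub>2_def)
        moreover have "(red (spike (int B)), 0) \<notin> V"
        proof
          assume "(red (spike (int B)), 0) \<in> V"
          then have "supp_within (- int B) (int B) (red (spike (int B)))" using True by (auto simp: K\<^sub>1_def)
          then have "int p dvd red (spike (int B)) (int B) 0" unfolding supp_within_def by blast
          then show False using not_p_dvd_1 by (simp add: spike_def dvd_mod_iff)
        qed
        ultimately have ne: "K\<^sub>2 \<noteq> V" by metis
        have "(f, k) \<in> K\<^sub>2 \<longleftrightarrow> (f, k) \<in> V" if F: "(f, k) \<in> F" and C: "(f, k) \<in> carrier G" for f k
        proof -
          have "red (f(int B := 0)) = red f"
            using B[OF F C] unfolding red_eq_iff by (auto simp: supp_within_def)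
          then show ?thesis
            using C carrier_mem_iff_lift[OF C] lift_cong[of "f(int B := 0)" k V f] lift_cong[of f k V "f(int B := 0)"]
            by (auto simp: K\<^sub>2_def)
        qed
        moreover have "K\<^sub>2 \<subseteq> carrier G" by (auto simp: K\<^sub>2_def)
        ultimately have "K\<^sub>2 \<inter> F = V \<inter> F" using sub by auto
        moreover have "K\<^sub>2 \<in> base_subgroups" unfolding K\<^sub>2_def by (rule base_enlarge[OF V])
        ultimately show ?thesis using ne by (intro bexI[of _ K\<^sub>2] conjI)
      qed
    qed
    then show "V \<in> sub_deriv base_subgroups" using V by (simp add: sub_deriv_def)
  qed
qed

subsection \<open>Upper bound for the rank\<close>

definition lamp_part :: "((int \<Rightarrow> nat \<Rightarrow> int) \<times> int) set \<Rightarrow> (int \<Rightarrow> nat \<Rightarrow> int) set" where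
  "lamp_part H = {f. (f, 0) \<in> lift H}"

text \<open>With the shift by \<open>T\<close> read as multiplication by a variable, these are the
  submodules of the lamp configurations over the integer Laurent polynomials.\<close>

definition submodule :: "int \<Rightarrow> (int \<Rightarrow> nat \<Rightarrow> int) set \<Rightarrow> bool" where
  "submodule T M \<longleftrightarrow> M \<subseteq> lamps \<and> 0 \<in> M \<and> (\<forall>f\<in>M. \<forall>g\<in>M. f - g \<in> M) \<and> (\<forall>f\<in>M. \<forall>q. shift (q * T) f \<in> M)"

lemma submodule_add:
  assumes "submodule T M" "f \<in> M" "g \<in> M" shows "f + g \<in> M"
proof -
  have "f - (0 - g) \<in> M" using assms by (simp only: submodule_def)
  then show ?thesis by simp
qed

lemma submodule_Int: "submodule T M \<Longrightarrow> submodule T N \<Longrightarrow> submodule T (M \<inter> N)"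
  by (auto simp: submodule_def)

lemma lift_power:
  assumes H: "subgroup H G" and h: "(h, T) \<in> lift H"
  obtains u where "(u, q * T) \<in> lift H"
proof -
  have nat: "\<exists>u. (u, int m * T) \<in> lift H" for m
  proof (induction m)
    case 0
    show ?case using lift_zero[OF H] by auto
  next
    case (Suc m)
    then obtain u where "(u, int m * T) \<in> lift H" by blast
    from lift_mult[OF H h this] show ?case by (auto simp: algebra_simps)
  qed
  have "\<exists>u. (u, q * T) \<in> lift H"
  proof (cases q)
    case (nonneg m)
    then show ?thesis using nat by simp
  next
    case (neg m)
    obtain u where "(u, int (Suc m) * T) \<in> lift H" using nat by blast
    then have "(- shift (- (int (Suc m) * T)) u, - (int (Suc m) * T)) \<in> lift H" by (rule lift_inv[OF H])
    moreover have "- (int (Suc m) * T) = q * T" by (simp add: neg algebra_simps)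
    ultimately show ?thesis by metis
  qed
  then show thesis using that by blast
qed

text \<open>Conjugation by \<open>(u, k)\<close> acts on the abelian lamp group as the shift by
  \<open>k\<close>, whatever \<open>u\<close> is.\<close>

lemma lamp_part_conj:
  assumes H: "subgroup H G" and "(u, k) \<in> lift H" "f \<in> lamp_part H"
  shows "shift k f \<in> lamp_part H"
  using lift_mult[OF H lift_mult[OF H assms(2), of f 0] lift_inv[OF H assms(2)]] assms(3)
  by (simp add: lamp_part_def)

lemma submodule_lamp_part:
  assumes H: "subgroup H G" and h: "(h, T) \<in> lift H"
  shows "submodule T (lamp_part H)"
  unfolding submodule_def
proof (intro conjI ballI allI)
  show "lamp_part H \<subseteq> lamps" using lift_lamps[OF H] by (auto simp: lamp_part_def)
  show "0 \<in> lamp_part H" using lift_zero[OF H] by (simp add: lamp_part_def)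
  fix f assume f: "f \<in> lamp_part H"
  show "f - g \<in> lamp_part H" if "g \<in> lamp_part H" for g
    using lift_mult[OF H, of f 0 "- g" 0] lift_inv[OF H, of g 0] that f by (simp add: lamp_part_def)
  fix q
  obtain u where "(u, q * T) \<in> lift H" using lift_power[OF H h] .
  then show "shift (q * T) f \<in> lamp_part H" using lamp_part_conj[OF H] f by blast
qed

section \<open>Top blocks and division with remainder\<close>

definition supp_below :: "int \<Rightarrow> (int \<Rightarrow> nat \<Rightarrow> int) \<Rightarrow> bool" where
  "supp_below b f \<longleftrightarrow> (\<forall>i j. b \<le> i \<longrightarrow> int p dvd f i j)"

text \<open>For a configuration supported below \<open>T\<close> this reads positions 0 to
  \<open>T - 1\<close>. It is the analogue of a leading coefficient, with \<open>T\<close>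
  consecutive positions as one digit; the zero block is allowed.\<close>

definition top_block :: "(int \<Rightarrow> nat \<Rightarrow> int) \<Rightarrow> int \<Rightarrow> nat \<Rightarrow> int" where
  "top_block f = red (\<lambda>i j. if 0 \<le> i then f i j else 0)"

definition tops :: "int \<Rightarrow> (int \<Rightarrow> nat \<Rightarrow> int) set \<Rightarrow> (int \<Rightarrow> nat \<Rightarrow> int) set" where
  "tops T M = top_block ` {f \<in> M. supp_below T f}"

lemma top_block_eq_iff: "top_block f = top_block g \<longleftrightarrow> (\<forall>i\<ge>0. \<forall>j. int p dvd f i j - g i j)"
  unfolding top_block_def red_eq_iff by auto

lemma tops_window: assumes "M \<subseteq> lamps" shows "tops T M \<subseteq> window 0 T"
proof
  fix v assume "v \<in> tops T M"
  then obtain f where f: "f \<in> M" "supp_below T f" "v = top_block f" by (auto simp: tops_def)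
  let ?f = "\<lambda>i j. if 0 \<le> i then f i j else 0"
  have fl: "f \<in> lamps" using f(1) assms by blast
  have "{i. \<exists>j. \<not> int p dvd ?f i j} \<subseteq> {i. \<exists>j. \<not> int p dvd f i j}" by auto
  then have "finite {i. \<exists>j. \<not> int p dvd ?f i j}"
    by (rule finite_subset) (use fl in \<open>simp add: lamps_def\<close>)
  then have "?f \<in> lamps" using fl by (auto simp: lamps_def)
  moreover have "supp_within 0 T ?f" using f(2) by (auto simp: supp_within_def supp_below_def)
  ultimately show "v \<in> window 0 T" unfolding f(3) top_block_def by (rule windowI)
qed

text \<open>Division with remainder: subtracting shifts of elements of N with prescribed top blocks
  lowers the support of an element of M until it fits into a window of fixed width.\<close>

lemma division_bounded:
  fixes d k :: nat
  assumes M: "submodule T M" and N: "submodule T N" and NM: "N \<subseteq> M" and T: "0 < T"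
    and lead: "\<And>f. f \<in> M \<Longrightarrow> supp_below T f \<Longrightarrow>
      \<exists>g\<in>N. supp_within (- (int d * T)) T g \<and> top_block g = top_block f"
  shows "f \<in> M \<Longrightarrow> supp_within (q * T) ((q + int d + 1 + int k) * T) f \<Longrightarrow>
    \<exists>g\<in>N. supp_within (q * T) ((q + int d + 1) * T) (f - g)"
proof (induction k arbitrary: f)
  case 0
  then show ?case using N by (intro bexI[of _ 0]) (auto simp: submodule_def)
next
  case (Suc k)
  \<comment> \<open>Block \<open>m\<close>, from \<open>m * T\<close> up to
    \<open>(m + 1) * T\<close>, is the highest one that \<open>f\<close> may occupy. It is moved to
    block 0, where \<open>lead\<close> applies.\<close>
  define m where "m = q + int d + 1 + int k"
  have f: "supp_within (q * T) ((m + 1) * T) f" using Suc.prems(2) by (simp add: m_def algebra_simps)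
  have "shift ((- m) * T) f \<in> M" using Suc.prems(1) M unfolding submodule_def by blast
  moreover have "supp_below T (shift ((- m) * T) f)"
    using supp_within_shift[OF f, of "(- m) * T"]
    by (auto simp: supp_within_def supp_below_def algebra_simps)
  ultimately obtain g where g: "g \<in> N" "supp_within (- (int d * T)) T g"
    "top_block g = top_block (shift ((- m) * T) f)" using lead by blast
  define g' where "g' = shift (m * T) g"
  have g'N: "g' \<in> N" using g(1) N by (simp add: g'_def submodule_def)
  have "supp_within (- (int d * T) + m * T) (T + m * T) g'"
    unfolding g'_def by (rule supp_within_shift[OF g(2)])
  \<comment> \<open>The subtracted element reaches only \<open>d\<close> blocks below its top block
    \<open>m\<close>, so the support does not grow to the left of \<open>q * T\<close>.\<close>
  moreover have "q * T \<le> (m - int d) * T" using T by (intro mult_right_mono) (auto simp: m_def)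
  ultimately have low: "int p dvd g' i j" if "i < q * T" for i j
    using that by (auto simp: supp_within_def algebra_simps)
  have high: "int p dvd f i j - g' i j" if "m * T \<le> i" for i j
  proof -
    have "int p dvd g (i - m * T) j - shift ((- m) * T) f (i - m * T) j"
      using g(3) that unfolding top_block_eq_iff by simp
    then show ?thesis by (simp add: g'_def shift_apply dvd_diff_commute)
  qed
  have "supp_within (q * T) (m * T) (f - g')"
    using low high f by (auto simp: supp_within_def intro!: dvd_diff)
  moreover have "f - g' \<in> M" using Suc.prems(1) g'N NM M by (auto simp: submodule_def)
  ultimately obtain g'' where "g'' \<in> N" "supp_within (q * T) ((q + int d + 1) * T) (f - g' - g'')"
    using Suc.IH[of "f - g'"] unfolding m_def by blast
  then show ?case
    using submodule_add[OF N g'N] by (intro bexI[of _ "g' + g''"]) (simp_all only: diff_diff_eq)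
qed

text \<open>The remainder is moved into a window independent of \<open>f\<close>, so that finitely
  many configurations control all of \<open>M\<close>. The choice \<open>q = - B\<close> starts to
  the left of the support of \<open>f\<close>, and \<open>2 * B\<close> additional blocks reach past
  its right end.\<close>

lemma division:
  fixes d :: nat
  assumes M: "submodule T M" and N: "submodule T N" and NM: "N \<subseteq> M" and T: "0 < T"
    and lead: "\<And>f. f \<in> M \<Longrightarrow> supp_below T f \<Longrightarrow>
      \<exists>g\<in>N. supp_within (- (int d * T)) T g \<and> top_block g = top_block f"
    and f: "f \<in> M"
  obtains g q a where "g \<in> N" "a \<in> M" "supp_within 0 ((int d + 1) * T) a" "f = g + shift (q * T) a"
proof -
  have "f \<in> lamps" using f M by (auto simp: submodule_def)
  then obtain B where B: "supp_within (- int B) (int B) f" by (rule lamps_supp_within)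
  define q where "q = - int B"
  have BT: "int B \<le> int B * T" using T by (simp add: mult_le_cancel_left1)
  have "0 \<le> (int d + 1) * T" using T by simp
  then have "supp_within (q * T) ((q + int d + 1 + int (2 * B)) * T) f"
    using BT by (intro supp_within_mono[OF B]) (auto simp: q_def algebra_simps)
  from division_bounded[OF M N NM T lead f this] obtain g
    where g: "g \<in> N" "supp_within (q * T) ((q + int d + 1) * T) (f - g)" by blast
  have "f - g \<in> M" using g(1) NM f M by (auto simp: submodule_def)
  then have a: "shift ((- q) * T) (f - g) \<in> M" using M unfolding submodule_def by blast
  have "supp_within 0 ((int d + 1) * T) (shift ((- q) * T) (f - g))"
    using supp_within_shift[OF g(2), of "(- q) * T"] by (simp add: algebra_simps)
  from that[OF g(1) a this, of q] show thesis by simp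
qed

text \<open>This is the lamp configuration of the commutator of \<open>(f, s)\<close> and
  \<open>(h, T)\<close>. For fixed \<open>s\<close> it is a linear condition on \<open>f\<close>:
  two solutions differ by an element whose class modulo the lamp part is fixed by the shift by
  \<open>T\<close>.\<close>

lemma commutator_lift:
  assumes H: "subgroup H G" and h: "(h, T) \<in> lift H" and f: "(f, s) \<in> lift H"
  shows "f - shift T f + shift s h - h \<in> lamp_part H"
proof -
  have "(f + shift s h, s + T) \<in> lift H" by (rule lift_mult[OF H f h])
  moreover have "(- shift (- (T + s)) (h + shift T f), - (T + s)) \<in> lift H"
    by (rule lift_inv[OF H lift_mult[OF H h f]])
  ultimately have "(f + shift s h + shift (s + T) (- shift (- (T + s)) (h + shift T f)), s + T + - (T + s)) \<in> lift H"
    by (rule lift_mult[OF H])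
  moreover have "f + shift s h + shift (s + T) (- shift (- (T + s)) (h + shift T f)) =
      f - shift T f + shift s h - h" "s + T + - (T + s) = 0"
    by (simp_all add: add.commute algebra_simps)
  ultimately show ?thesis unfolding lamp_part_def by (simp only: mem_Collect_eq)
qed

text \<open>For \<open>q \<ge> 0\<close> the difference telescopes into shifts of
  \<open>a - shift T a\<close>; negative \<open>q\<close> follows by shifting back and changing
  sign.\<close>

lemma diff_shift_mult:
  assumes M: "submodule T M" and a: "a - shift T a \<in> M"
  shows "a - shift (q * T) a \<in> M"
proof -
  have nat: "a - shift (int m * T) a \<in> M" for m
  proof (induction m)
    case 0
    have "0 \<in> M" using M unfolding submodule_def by blast
    then show ?case by (simp only: of_nat_0 mult_zero_left shift_simps diff_self)
  next
    case (Suc m)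
    have "shift (int m * T) (a - shift T a) \<in> M" using a M unfolding submodule_def by blast
    from submodule_add[OF M Suc this]
    have "a - shift (int m * T + T) a \<in> M" by (simp only: shift_simps add_diff_eq diff_add_cancel)
    moreover have "int m * T + T = int (Suc m) * T" by (simp add: algebra_simps)
    ultimately show ?case by metis
  qed
  show ?thesis
  proof (cases q)
    case (nonneg m)
    then show ?thesis using nat by simp
  next
    case (neg m)
    have "shift (q * T) (a - shift (int (Suc m) * T) a) \<in> M"
      using nat M unfolding submodule_def by blast
    moreover have "q * T + int (Suc m) * T = 0" by (simp add: neg algebra_simps)
    ultimately have "shift (q * T) a - a \<in> M" by (metis shift_simps(2,5,6))
    moreover have "0 \<in> M" using M unfolding submodule_def by blast
    ultimately have "0 - (shift (q * T) a - a) \<in> M" using M unfolding submodule_def by blast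
    then show ?thesis by (simp only: diff_0 minus_diff_eq)
  qed
qed

text \<open>The elements whose class modulo M is fixed by the shift by T form a module with the same top
  blocks as M, since subtracting the shift downwards does not change the top block.\<close>

lemma submodule_fixed:
  assumes M: "submodule T M"
  shows "submodule T {g \<in> lamps. g - shift T g \<in> M}"
  unfolding submodule_def
proof (intro conjI ballI allI)
  show "0 \<in> {g \<in> lamps. g - shift T g \<in> M}" using M lamps_zero by (simp add: submodule_def)
  fix f assume f: "f \<in> {g \<in> lamps. g - shift T g \<in> M}"
  show "f - g \<in> {g \<in> lamps. g - shift T g \<in> M}" if g: "g \<in> {g \<in> lamps. g - shift T g \<in> M}" for g
  proof -
    have "(f - shift T f) - (g - shift T g) \<in> M" using f g M unfolding submodule_def by blast
    moreover have "(f - shift T f) - (g - shift T g) = (f - g) - shift T (f - g)" by simp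
    ultimately have "(f - g) - shift T (f - g) \<in> M" by metis
    then show ?thesis using f g lamps_diff by blast
  qed
  show "shift (q * T) f \<in> {g \<in> lamps. g - shift T g \<in> M}" for q
  proof -
    have "shift (q * T) (f - shift T f) \<in> M" using f M unfolding submodule_def by blast
    then have "shift (q * T) f - shift T (shift (q * T) f) \<in> M"
      by (simp only: shift_simps add.commute)
    then show ?thesis using f lamps_shift by blast
  qed
qed auto

lemma top_block_fixed:
  assumes M: "submodule T M" and T: "0 < T" and g: "g - shift T g \<in> M" "supp_below T g"
  shows "top_block g \<in> tops T M"
proof -
  define g' where "g' = g - shift (- T) g"
  have "shift ((-1) * T) (g - shift T g) \<in> M" using g(1) M unfolding submodule_def by blast
  moreover have "0 \<in> M" using M unfolding submodule_def by blast
  ultimately have "0 - shift ((-1) * T) (g - shift T g) \<in> M" using M unfolding submodule_def by blast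
  moreover have "0 - shift ((-1) * T) (g - shift T g) = g'" by (simp add: g'_def)
  ultimately have "g' \<in> M" by metis
  moreover have "int p dvd shift (- T) g i j" if "0 \<le> i" for i j
    using g(2) that by (simp add: supp_below_def shift_apply)
  then have "supp_below T g'" "top_block g = top_block g'"
    using g(2) T unfolding top_block_eq_iff by (auto simp: g'_def supp_below_def)
  ultimately show ?thesis unfolding tops_def by blast
qed

text \<open>\<open>F\<close> collects an element of \<open>M\<close> for each top block, the element
  \<open>(h, T)\<close>, all configurations in the window of division remainders, and for each
  \<open>s\<close> from 0 to \<open>T - 1\<close> the candidates \<open>sol s + w\<close> with
  \<open>w\<close> in that window. The first two kinds put the top blocks of \<open>H\<close> into
  \<open>K\<close>; the other two decide equality.\<close>

lemma isolating_set:
  assumes H: "subgroup H G" and h: "(h, T) \<in> lift H" and T: "0 < T"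
  obtains F where "finite F"
    "\<And>K. subgroup K G \<Longrightarrow> K \<inter> F = H \<inter> F \<Longrightarrow>
      (h, T) \<in> lift K \<and> tops T (lamp_part H) \<subseteq> tops T (lamp_part K) \<and>
      (tops T (lamp_part K) = tops T (lamp_part H) \<longrightarrow> K = H)"
proof -
  define M where "M = lamp_part H"
  have M: "submodule T M" unfolding M_def by (rule submodule_lamp_part[OF H h])
  have Ml: "M \<subseteq> lamps" using M by (simp add: submodule_def)
  have fin: "finite (tops T M)" by (rule finite_subset[OF tops_window[OF Ml] finite_window])
  have "\<forall>v\<in>tops T M. \<exists>f\<in>M. supp_below T f \<and> top_block f = v" by (auto simp: tops_def)
  then obtain lead where lead: "\<And>v. v \<in> tops T M \<Longrightarrow> lead v \<in> M"
    "\<And>v. v \<in> tops T M \<Longrightarrow> supp_below T (lead v)" "\<And>v. v \<in> tops T M \<Longrightarrow> top_block (lead v) = v"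
    by metis
  have "finite (lead ` tops T M)" "lead ` tops T M \<subseteq> lamps" using fin lead(1) Ml by auto
  then obtain d :: nat where d: "\<And>f. f \<in> lead ` tops T M \<Longrightarrow> supp_within (- int d) (int d) f"
    by (rule finite_bounded_supp) blast
  have "int d \<le> int d * T" using T by (simp add: mult_le_cancel_left1)
  then have lead4: "supp_within (- (int d * T)) T (lead v)" if "v \<in> tops T M" for v
    using d[OF imageI[OF that]] lead(2)[OF that] by (auto simp: supp_within_def supp_below_def)
  define W where "W = window 0 ((int d + 1) * T)"
  \<comment> \<open>One solution of the commutator condition for each \<open>s\<close>, chosen
    independently of \<open>K\<close>. It is used only when some element with position
    \<open>s\<close> shows that a solution exists.\<close>
  define sol where "sol s = (SOME f. f \<in> lamps \<and> f - shift T f + shift s h - h \<in> M)" for s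
  define F where "F = (\<lambda>v. (red (lead v), 0 :: int)) ` tops T M \<union> {(red h, T)} \<union> (\<lambda>w. (w, 0)) ` W \<union>
    (\<lambda>(s, w). (red (sol s + w), s)) ` ({0..<T} \<times> W)"
  have finW: "finite W" unfolding W_def by (rule finite_window)
  have "finite F" unfolding F_def using fin finW by simp
  have F1: "(lead v, 0) \<in> lift K" if K: "K \<inter> F = H \<inter> F" and v: "v \<in> tops T M" for K v
  proof -
    have "(red (lead v), 0) \<in> F" unfolding F_def using v by blast
    moreover have "(red (lead v), 0) \<in> H" using lead(1)[OF v] by (simp add: M_def lamp_part_def lift_def)
    ultimately have "(red (lead v), 0) \<in> K" using K by blast
    then show ?thesis by (simp add: lift_def)
  qed
  have F2: "(h, T) \<in> lift K" if K: "K \<inter> F = H \<inter> F" for K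
  proof -
    have "(red h, T) \<in> F" unfolding F_def by blast
    moreover have "(red h, T) \<in> H" using h by (simp add: lift_def)
    ultimately have "(red h, T) \<in> K" using K by blast
    then show ?thesis by (simp add: lift_def)
  qed
  have F3: "a \<in> lamp_part K \<longleftrightarrow> a \<in> M"
    if K: "K \<inter> F = H \<inter> F" and a: "a \<in> lamps" "supp_within 0 ((int d + 1) * T) a" for K a
  proof -
    have "red a \<in> W" unfolding W_def by (rule windowI[OF a])
    then have "(red a, 0) \<in> F" unfolding F_def by blast
    then have "(red a, 0) \<in> K \<longleftrightarrow> (red a, 0) \<in> H" using K by blast
    then show ?thesis by (simp add: M_def lamp_part_def lift_def)
  qed
  have F4: "(sol s + a, s) \<in> lift K \<longleftrightarrow> (sol s + a, s) \<in> lift H"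
    if K: "K \<inter> F = H \<inter> F" and a: "a \<in> lamps" "supp_within 0 ((int d + 1) * T) a" and s: "s \<in> {0..<T}" for K a s
  proof -
    have "red a \<in> W" unfolding W_def by (rule windowI[OF a])
    moreover have "red (sol s + a) = red (sol s + red a)" by (simp add: mod_simps)
    ultimately have "(red (sol s + a), s) \<in> (\<lambda>(s, w). (red (sol s + w), s)) ` ({0..<T} \<times> W)"
      using s by (intro image_eqI[of _ _ "(s, red a)"]) (simp_all only: case_prod_conv mem_Sigma_iff)
    then have "(red (sol s + a), s) \<in> F" unfolding F_def by blast
    then have "(red (sol s + a), s) \<in> K \<longleftrightarrow> (red (sol s + a), s) \<in> H" using K by blast
    then show ?thesis unfolding lift_def mem_Collect_eq case_prod_conv .
  qed
  have good: "\<exists>g\<in>N. supp_within (- (int d * T)) T g \<and> top_block g = top_block f"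
    if "\<And>v. v \<in> tops T M \<Longrightarrow> lead v \<in> N" "top_block f \<in> tops T M" for N f
    using that lead(3) lead4 by blast
  \<comment> \<open>Stated for two subgroups agreeing with \<open>H\<close> on \<open>F\<close>, so
    that one argument gives both inclusions.\<close>
  have parts: "lamp_part K\<^sub>1 \<subseteq> lamp_part K\<^sub>2"
    if K: "subgroup K\<^sub>1 G" "K\<^sub>1 \<inter> F = H \<inter> F" "tops T (lamp_part K\<^sub>1) = tops T M"
      "subgroup K\<^sub>2 G" "K\<^sub>2 \<inter> F = H \<inter> F" for K\<^sub>1 K\<^sub>2
  proof
    fix f assume f: "f \<in> lamp_part K\<^sub>1"
    \<comment> \<open>Both lamp parts contain the chosen lead elements, so division by their
      intersection is possible. The remainder lies in the window, where agreement on
      \<open>F\<close> decides membership.\<close>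
    define N where "N = lamp_part K\<^sub>1 \<inter> lamp_part K\<^sub>2"
    have M1: "submodule T (lamp_part K\<^sub>1)" by (rule submodule_lamp_part[OF K(1) F2[OF K(2)]])
    have M2: "submodule T (lamp_part K\<^sub>2)" by (rule submodule_lamp_part[OF K(4) F2[OF K(5)]])
    have N: "submodule T N" unfolding N_def by (rule submodule_Int[OF M1 M2])
    have leadN: "lead v \<in> N" if "v \<in> tops T M" for v
      using F1[OF K(2) that] F1[OF K(5) that] by (simp add: N_def lamp_part_def)
    have "\<exists>g\<in>N. supp_within (- (int d * T)) T g \<and> top_block g = top_block f"
      if "f \<in> lamp_part K\<^sub>1" "supp_below T f" for f
    proof -
      have "top_block f \<in> tops T M" using that K(3) unfolding tops_def by blast
      then show ?thesis by (rule good[rotated]) (rule leadN)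
    qed
    then obtain g q a where g: "g \<in> N" "a \<in> lamp_part K\<^sub>1" "supp_within 0 ((int d + 1) * T) a"
      "f = g + shift (q * T) a"
      using division[OF M1 N _ T _ f, of d] unfolding N_def by blast
    have "a \<in> lamps" using g(2) M1 by (auto simp: submodule_def)
    then have "a \<in> lamp_part K\<^sub>2" using F3[OF K(2) _ g(3)] F3[OF K(5) _ g(3)] g(2) by blast
    then have "shift (q * T) a \<in> lamp_part K\<^sub>2" using M2 by (simp add: submodule_def)
    then show "f \<in> lamp_part K\<^sub>2" unfolding g(4) using g(1) submodule_add[OF M2] N_def by blast
  qed
  have all: "K\<^sub>1 \<subseteq> K\<^sub>2"
    if K: "subgroup K\<^sub>1 G" "K\<^sub>1 \<inter> F = H \<inter> F" "tops T (lamp_part K\<^sub>1) = tops T M"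
      "subgroup K\<^sub>2 G" "K\<^sub>2 \<inter> F = H \<inter> F" "tops T (lamp_part K\<^sub>2) = tops T M" for K\<^sub>1 K\<^sub>2
    unfolding subgroup_subset_iff[OF K(1)]
  proof clarify
    fix f \<sigma> assume f: "(f, \<sigma>) \<in> lift K\<^sub>1"
    have p1: "lamp_part K\<^sub>1 = M" unfolding M_def
      by (intro equalityI parts) (simp_all add: K H M_def)
    have p2: "lamp_part K\<^sub>2 = M" unfolding M_def
      by (intro equalityI parts) (simp_all add: K H M_def)
    \<comment> \<open>An element with position a multiple of \<open>T\<close> that lies in both
      subgroups reduces \<open>\<sigma>\<close> to its residue \<open>s\<close>; working in the
      intersection yields a common \<open>u\<close>.\<close>
    have I: "subgroup (K\<^sub>1 \<inter> K\<^sub>2) G" by (rule group.subgroups_Inter_pair[OF group_G K(1) K(4)])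
    have "(h, T) \<in> lift (K\<^sub>1 \<inter> K\<^sub>2)" using F2[OF K(2)] F2[OF K(5)] by (simp add: lift_def)
    then obtain u where "(u, (- (\<sigma> div T)) * T) \<in> lift (K\<^sub>1 \<inter> K\<^sub>2)" using lift_power[OF I] by blast
    then have u: "(u, - (\<sigma> div T * T)) \<in> lift K\<^sub>1" "(u, - (\<sigma> div T * T)) \<in> lift K\<^sub>2" by (auto simp: lift_def)
    define s where "s = \<sigma> mod T"
    have s: "s \<in> {0..<T}" using T by (simp add: s_def)
    have \<sigma>: "\<sigma> + - (\<sigma> div T * T) = s" "s + \<sigma> div T * T = \<sigma>" by (simp_all add: s_def minus_div_mult_eq_mod)
    define f' where "f' = f + shift \<sigma> u"
    have f': "(f', s) \<in> lift K\<^sub>1" using lift_mult[OF K(1) f u(1)] unfolding f'_def \<sigma> .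
    have "f' \<in> lamps" by (rule lift_lamps[OF K(1) f'])
    moreover have comm: "f' - shift T f' + shift s h - h \<in> M"
      using commutator_lift[OF K(1) F2[OF K(2)] f'] p1 by simp
    ultimately have "\<exists>f. f \<in> lamps \<and> f - shift T f + shift s h - h \<in> M" by blast
    then have "sol s \<in> lamps \<and> sol s - shift T (sol s) + shift s h - h \<in> M"
      unfolding sol_def by (rule someI_ex)
    then have sol: "sol s \<in> lamps" "sol s - shift T (sol s) + shift s h - h \<in> M" by blast+
    \<comment> \<open>The difference of the two solutions \<open>f'\<close> and \<open>sol s\<close>
      lies in \<open>M'\<close>. Since \<open>M'\<close> has no top blocks beyond those of
      \<open>M\<close>, it can be divided by \<open>M\<close>.\<close>
    define M' where "M' = {g \<in> lamps. g - shift T g \<in> M}"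
    have M': "submodule T M'" unfolding M'_def by (rule submodule_fixed[OF M])
    have sub: "M \<subseteq> M'"
    proof
      fix g assume g: "g \<in> M"
      then have "shift (1 * T) g \<in> M" using M unfolding submodule_def by blast
      then have "shift T g \<in> M" by (simp only: mult_1)
      then have "g - shift T g \<in> M" using M g unfolding submodule_def by blast
      then show "g \<in> M'" using g Ml by (auto simp: M'_def)
    qed
    have mem: "f' - sol s \<in> M'"
    proof -
      have "(f' - shift T f' + shift s h - h) - (sol s - shift T (sol s) + shift s h - h) \<in> M"
        using comm sol(2) M unfolding submodule_def by blast
      moreover have "(f' - shift T f' + shift s h - h) - (sol s - shift T (sol s) + shift s h - h) =
          (f' - sol s) - shift T (f' - sol s)" by simp
      ultimately have "(f' - sol s) - shift T (f' - sol s) \<in> M" by metis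
      then show ?thesis using lamps_diff[OF \<open>f' \<in> lamps\<close> sol(1)] by (simp add: M'_def)
    qed
    have ld: "\<exists>g\<in>M. supp_within (- (int d * T)) T g \<and> top_block g = top_block f"
      if "f \<in> M'" "supp_below T f" for f
    proof -
      have "top_block f \<in> tops T M" using that by (intro top_block_fixed[OF M T]) (auto simp: M'_def)
      then show ?thesis by (rule good[rotated]) (rule lead(1))
    qed
    obtain g q a where g: "g \<in> M" "a \<in> M'" "supp_within 0 ((int d + 1) * T) a"
      "f' - sol s = g + shift (q * T) a"
      by (rule division[OF M' M sub T ld mem]) blast
    have a: "a \<in> lamps" "a - shift T a \<in> M" using g(2) by (auto simp: M'_def)
    \<comment> \<open>Because \<open>a\<close> lies in \<open>M'\<close>, it is congruent modulo
      \<open>M\<close> to all its shifts by multiples of \<open>T\<close>. Hence \<open>f'\<close>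
      is congruent to \<open>sol s + a\<close>, one of the finitely many candidates tested by
      \<open>F\<close>.\<close>
    define m where "m = g - (a - shift (q * T) a)"
    have m: "m \<in> M" using g(1) diff_shift_mult[OF M a(2)] M unfolding m_def submodule_def by blast
    have f'_eq: "f' = m + (sol s + a)" using g(4) by (simp add: m_def algebra_simps)
    have "(m, 0) \<in> lift K\<^sub>1" using m p1 unfolding lamp_part_def by blast
    from lift_mult[OF K(1) lift_inv[OF K(1) this] f']
    have "(sol s + a, s) \<in> lift K\<^sub>1"
      by (simp only: f'_eq minus_zero shift_simps add_0 minus_add_cancel)
    then have "(sol s + a, s) \<in> lift K\<^sub>2"
      using F4[OF K(2) a(1) g(3) s] F4[OF K(5) a(1) g(3) s] by blast
    moreover have "(m, 0) \<in> lift K\<^sub>2" using m p2 unfolding lamp_part_def by blast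
    ultimately have "(f', s) \<in> lift K\<^sub>2" using lift_mult[OF K(4), of m 0 "sol s + a" s] by (simp only: f'_eq shift_simps add_0)
    from lift_mult[OF K(4) this lift_inv[OF K(4) u(2)]] show "(f, \<sigma>) \<in> lift K\<^sub>2"
      by (simp only: f'_def \<sigma> shift_simps minus_minus add_diff_cancel_right' flip: diff_conv_add_uminus)
  qed
  show thesis
  proof (rule that[OF \<open>finite F\<close>])
    fix K assume K: "subgroup K G" "K \<inter> F = H \<inter> F"
    have "v \<in> tops T (lamp_part K)" if v: "v \<in> tops T M" for v
      using F1[OF K(2) v] lead(2,3)[OF v] unfolding tops_def lamp_part_def by force
    then have "tops T M \<subseteq> tops T (lamp_part K)" by blast
    moreover have "tops T (lamp_part H) = tops T M" by (simp only: M_def)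
    then have "K = H" if "tops T (lamp_part K) = tops T M"
      using all[OF K that H refl] all[OF H refl _ K that] by blast
    ultimately show "(h, T) \<in> lift K \<and> tops T (lamp_part H) \<subseteq> tops T (lamp_part K) \<and>
      (tops T (lamp_part K) = tops T (lamp_part H) \<longrightarrow> K = H)"
      using F2[OF K(2)] unfolding M_def by blast
  qed
qed

section \<open>The finite derivatives and their intersection\<close>

definition stage :: "nat \<Rightarrow> ((int \<Rightarrow> nat \<Rightarrow> int) \<times> int) set set" where
  "stage k = (sub_deriv ^^ k) {H. subgroup H G}"

lemma stage_Suc: "stage (Suc k) = sub_deriv (stage k)" by (simp add: stage_def)

lemma stage_subgroup: "H \<in> stage k \<Longrightarrow> subgroup H G"
  by (induction k) (auto simp: stage_def sub_deriv_def)

lemma stage_antimono: "m \<le> k \<Longrightarrow> stage k \<subseteq> stage m"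
  by (induction rule: dec_induct) (auto simp: stage_Suc sub_deriv_def)

lemma base_subset_stage: "base_subgroups \<subseteq> stage k"
proof (induction k)
  case 0
  show ?case by (auto simp: base_subgroups_def stage_def)
next
  case (Suc k)
  have "sub_deriv base_subgroups \<subseteq> sub_deriv (stage k)"
    using Suc unfolding sub_deriv_def by blast
  then show ?case by (simp add: sub_deriv_base stage_Suc)
qed

text \<open>The numerical assumption says that fewer than \<open>k\<close> blocks are missing from
  the top blocks of \<open>H\<close>. Near \<open>H\<close> every other subgroup containing
  \<open>(h, T)\<close> in its lift has strictly more top blocks, so each derivative uses up at
  least one missing block; for \<open>k = 0\<close> the assumption is contradictory.\<close>

lemma not_in_stage:
  assumes "subgroup H G" "(h, T) \<in> lift H" "0 < T"
    and "card (window 0 T) < card (tops T (lamp_part H)) + k"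
  shows "H \<notin> stage k"
  using assms
proof (induction k arbitrary: H)
  case 0
  have "tops T (lamp_part H) \<subseteq> window 0 T"
    using submodule_lamp_part[OF 0(1,2)] by (intro tops_window) (simp add: submodule_def)
  from card_mono[OF finite_window this] 0 show ?case by simp
next
  case (Suc k)
  obtain F where F: "finite F" "\<And>K. subgroup K G \<Longrightarrow> K \<inter> F = H \<inter> F \<Longrightarrow>
      (h, T) \<in> lift K \<and> tops T (lamp_part H) \<subseteq> tops T (lamp_part K) \<and>
      (tops T (lamp_part K) = tops T (lamp_part H) \<longrightarrow> K = H)"
    by (rule isolating_set[OF Suc.prems(1-3)]) blast
  show ?case
  proof
    assume "H \<in> stage (Suc k)"
    then obtain K where K: "K \<in> stage k" "K \<noteq> H" "K \<inter> F = H \<inter> F"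
      using F(1) unfolding stage_Suc sub_deriv_def by blast
    have KG: "subgroup K G" by (rule stage_subgroup[OF K(1)])
    have "tops T (lamp_part H) \<subset> tops T (lamp_part K)" "(h, T) \<in> lift K"
      using F(2)[OF KG K(3)] K(2) by auto
    moreover have "tops T (lamp_part K) \<subseteq> window 0 T"
      using submodule_lamp_part[OF KG \<open>(h, T) \<in> lift K\<close>] by (intro tops_window) (simp add: submodule_def)
    then have "finite (tops T (lamp_part K))" using finite_window finite_subset by blast
    ultimately have "card (tops T (lamp_part H)) < card (tops T (lamp_part K))" "(h, T) \<in> lift K"
      by (simp_all add: psubset_card_mono)
    then show False using Suc.IH[OF KG] Suc.prems(3,4) K(1) by simp
  qed
qed

text \<open>A subgroup not contained in the lamp group has, after inversion if necessary, an element
  of positive position. It is lost once the number of stages exceeds the number of blocks of that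
  length.\<close>

lemma Inter_stage: "(\<Inter>k. stage k) = base_subgroups"
proof
  show "base_subgroups \<subseteq> (\<Inter>k. stage k)" using base_subset_stage by blast
  show "(\<Inter>k. stage k) \<subseteq> base_subgroups"
  proof
    fix H assume H: "H \<in> (\<Inter>k. stage k)"
    then have HG: "subgroup H G" using stage_subgroup by blast
    have "k = 0" if fk: "(f, k) \<in> H" for f k
    proof (rule ccontr)
      assume "k \<noteq> 0"
      have "(f, k) \<in> lift H" using fk subgroup.subset[OF HG] carrier_mem_iff_lift by blast
      then have "\<exists>h. (h, \<bar>k\<bar>) \<in> lift H"
        using lift_inv[OF HG, of f k] by (cases "k < 0") auto
      then obtain h where "(h, \<bar>k\<bar>) \<in> lift H" by blast
      then have "H \<notin> stage (Suc (card (window 0 \<bar>k\<bar>)))"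
        using \<open>k \<noteq> 0\<close> by (intro not_in_stage[OF HG]) auto
      then show False using H by blast
    qed
    then show "H \<in> base_subgroups" using HG by (simp add: base_subgroups_def)
  qed
qed

subsection \<open>Lower bound for the rank\<close>

text \<open>On the residue class r mod t, the map g to g - stretch t e g is multiplication by
  1 - x to the power e r; classes with e r = 0 are killed.\<close>

definition stretch :: "int \<Rightarrow> (int \<Rightarrow> int) \<Rightarrow> (int \<Rightarrow> nat \<Rightarrow> int) \<Rightarrow> int \<Rightarrow> nat \<Rightarrow> int" where
  "stretch t e g = (\<lambda>i. g (i - e (i mod t)))"

definition stretch_sub :: "int \<Rightarrow> (int \<Rightarrow> int) \<Rightarrow> ((int \<Rightarrow> nat \<Rightarrow> int) \<times> int) set" where
  "stretch_sub t e = {(f, k). t dvd k \<and> (\<exists>g\<in>lamps. red f = red (g - stretch t e g))} \<inter> carrier G"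

lemma stretch_simps:
  "stretch t e (f + g) = stretch t e f + stretch t e g" "stretch t e (- g) = - stretch t e g"
  by (auto simp: stretch_def fun_eq_iff)

lemma stretch_shift: "t dvd k \<Longrightarrow> stretch t e (shift k g) = shift k (stretch t e g)"
proof -
  assume "t dvd k"
  then have "(i - k) mod t = i mod t" for i by (simp add: mod_eq_dvd_iff)
  then show ?thesis by (auto simp: stretch_def shift_def fun_eq_iff algebra_simps)
qed

lemma red_shift: "red (shift k f) = shift k (red f)" by (simp add: shift_def)

lemma red_cong_add: "red f = red f' \<Longrightarrow> red g = red g' \<Longrightarrow> red (f + g) = red (f' + g')"
  unfolding red_eq_iff plus_fun_apply by (simp add: add_diff_add)

lemma red_cong_uminus: "red f = red f' \<Longrightarrow> red (- f) = red (- f')"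
  unfolding red_eq_iff by (simp add: dvd_diff_commute)

lemma red_cong_shift: "red f = red f' \<Longrightarrow> red (shift k f) = red (shift k f')"
  by (simp only: red_shift)

text \<open>The map sending \<open>g\<close> to \<open>g - stretch t e g\<close> is additive and
  commutes with shifts by multiples of \<open>t\<close>, since these preserve residue
  classes.\<close>

lemma subgroup_stretch_sub: "subgroup (stretch_sub t e) G"
  unfolding stretch_sub_def
proof (rule subgroupI_lift)
  let ?S = "{(f, k). t dvd k \<and> (\<exists>g\<in>lamps. red f = red (g - stretch t e g))}"
  have "0 - stretch t e 0 = 0" by (auto simp: stretch_def fun_eq_iff)
  then have "red 0 = red (0 - stretch t e 0)" by metis
  then show "(0, 0) \<in> ?S" using lamps_zero by blast
  show "(f' + shift k f, k + l) \<in> ?S" if S: "(f', k) \<in> ?S" "(f, l) \<in> ?S" for f' k f l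
  proof -
    obtain g' where g': "g' \<in> lamps" "red f' = red (g' - stretch t e g')" and k: "t dvd k"
      using S by blast
    obtain g where g: "g \<in> lamps" "red f = red (g - stretch t e g)" and l: "t dvd l"
      using S by blast
    have "red (f' + shift k f) = red (g' - stretch t e g' + shift k (g - stretch t e g))"
      by (intro red_cong_add red_cong_shift g g')
    also have "g' - stretch t e g' + shift k (g - stretch t e g) =
        (g' + shift k g) - stretch t e (g' + shift k g)"
      by (simp add: stretch_simps stretch_shift[OF k] algebra_simps)
    finally show ?thesis unfolding mem_Collect_eq case_prod_conv
      by (rule conjI[OF dvd_add[OF k l] bexI[OF _ lamps_add[OF g'(1) lamps_shift[OF g(1)]]]])
  qed
  show "(- shift (- k) f, - k) \<in> ?S" if S: "(f, k) \<in> ?S" for f k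
  proof -
    obtain g where g: "g \<in> lamps" "red f = red (g - stretch t e g)" and k: "t dvd k"
      using S by blast
    have "red (- shift (- k) f) = red (- shift (- k) (g - stretch t e g))"
      by (intro red_cong_uminus red_cong_shift g)
    also have "- shift (- k) (g - stretch t e g) = - shift (- k) g - stretch t e (- shift (- k) g)"
      using k by (simp add: stretch_simps stretch_shift)
    finally show ?thesis unfolding mem_Collect_eq case_prod_conv dvd_minus_iff
      by (rule conjI[OF k bexI[OF _ lamps_uminus[OF lamps_shift[OF g(1)]]]])
  qed
qed auto

lemma mem_stretch_sub_iff:
  assumes "(f, k) \<in> carrier G"
  shows "(f, k) \<in> stretch_sub t e \<longleftrightarrow>
    t dvd k \<and> (\<exists>g\<in>lamps. \<forall>i j. int p dvd f i j - (g i j - g (i - e (i mod t)) j))"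
  using assms unfolding stretch_sub_def red_eq_iff by (simp add: stretch_def)

text \<open>Along a progression with step \<open>E\<close> the values are constant mod
  \<open>p\<close>, and finite support forces the constant to be 0. Either sign of \<open>E\<close>
  is allowed, so the progression may run in both directions.\<close>

lemma lamps_periodic_zero:
  assumes g: "g \<in> lamps" and E: "E \<noteq> 0"
    and step: "\<And>q. int p dvd g (i + int q * E) j - g (i + int (Suc q) * E) j"
  shows "int p dvd g i j"
proof -
  obtain B where B: "supp_within (- int B) (int B) g" using g by (rule lamps_supp_within)
  have diff: "int p dvd g i j - g (i + int q * E) j" for q
  proof (induction q)
    case (Suc q)
    from dvd_add[OF this step[of q]] show ?case by simp
  qed simp
  define q where "q = B + nat \<bar>i\<bar> + 1"
  have "1 \<le> \<bar>E\<bar>" using E by linarith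
  then have "int q \<le> int q * \<bar>E\<bar>" by (simp add: mult_le_cancel_left1)
  then have "int B + \<bar>i\<bar> + 1 \<le> \<bar>int q * E\<bar>" unfolding abs_mult by (simp add: q_def)
  then have "i + int q * E < - int B \<or> int B \<le> i + int q * E" by arith
  then have "int p dvd g (i + int q * E) j" using B by (auto simp: supp_within_def)
  from dvd_add[OF diff[of q] this] show ?thesis by simp
qed

lemma lamps_restrict:
  assumes "g \<in> lamps" shows "(\<lambda>i. if P i then 0 else g i) \<in> lamps"
proof -
  have "{i. \<exists>j. \<not> int p dvd (if P i then 0 else g i) j} \<subseteq> {i. \<exists>j. \<not> int p dvd g i j}" by auto
  then have "finite {i. \<exists>j. \<not> int p dvd (if P i then 0 else g i) j}"
    by (rule finite_subset) (use assms in \<open>simp add: lamps_def\<close>)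
  then show ?thesis using assms by (auto simp: lamps_def)
qed

text \<open>If E exceeds the width of the support of f, then 1 - x to the power E can only divide f
  on a residue class where f vanishes.\<close>

lemma stretch_sub_agree:
  assumes t: "\<And>r. t dvd e r" and r: "e r = 0" and E: "t dvd E" "2 * int B < E"
    and C: "(f, k) \<in> carrier G" and f: "supp_within (- int B) (int B) f"
  shows "(f, k) \<in> stretch_sub t (e(r := E)) \<longleftrightarrow> (f, k) \<in> stretch_sub t e"
proof -
  have mod: "(i - e s) mod t = i mod t" "(i - E) mod t = i mod t" for i s
    using t[of s] E(1) by (simp_all add: mod_eq_dvd_iff)
  \<comment> \<open>Once \<open>f\<close> vanishes on class \<open>r\<close>, clearing that class
    turns a witness for one exponent function into a witness for the other.\<close>
  define cut where "cut g = (\<lambda>i. if i mod t = r then 0 else g i)" for g :: "int \<Rightarrow> nat \<Rightarrow> int"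
  have cut: "cut g \<in> lamps" if "g \<in> lamps" for g unfolding cut_def by (rule lamps_restrict[OF that])
  have cutI: "int p dvd f i j - (cut g i j - cut g (i - e' (i mod t)) j)"
    if "e' = e \<or> e' = e(r := E)" and "i mod t = r \<Longrightarrow> int p dvd f i j"
      and "i mod t \<noteq> r \<Longrightarrow> int p dvd f i j - (g i j - g (i - e (i mod t)) j)" for e' g i j
    using that by (auto simp: cut_def mod)
  \<comment> \<open>As \<open>E\<close> exceeds the window width, \<open>f\<close> vanishes on the
    progression through \<open>i\<close> with step \<open>E\<close> except possibly at
    \<open>i\<close> itself. So \<open>g\<close> is constant mod \<open>p\<close> from
    \<open>i\<close> upwards and from \<open>i - E\<close> downwards, hence zero on both sides, and
    \<open>f i\<close>, congruent to \<open>g i - g (i - E)\<close>, vanishes too.\<close>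
  have zero: "int p dvd f i j"
    if g: "g \<in> lamps" "\<And>i j. int p dvd f i j - (g i j - g (i - (e(r := E)) (i mod t)) j)" and i: "i mod t = r"
    for g i j
  proof (cases "- int B \<le> i \<and> i < int B")
    case True
    have m: "(i + q * E) mod t = r" for q using i E(1) by (auto simp: mod_eq_dvd_iff elim!: dvdE)
    have st: "int p dvd f (i + q * E) j - (g (i + q * E) j - g (i + (q - 1) * E) j)" for q
    proof -
      have "i + (q - 1) * E = i + q * E - E" by (simp add: algebra_simps)
      then show ?thesis using g(2)[of "i + q * E" j] by (simp only: m fun_upd_same)
    qed
    have out: "int p dvd f (i + q * E) j" if "q \<noteq> 0" for q
    proof -
      have "E \<le> \<bar>q * E\<bar>" using that E(2) by (simp add: abs_mult mult_le_cancel_right1)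
      then have "i + q * E < - int B \<or> int B \<le> i + q * E" using True E(2) by linarith
      then show ?thesis using f by (auto simp: supp_within_def)
    qed
    have gg: "int p dvd g (i + q * E) j - g (i + (q - 1) * E) j" if "q \<noteq> 0" for q
      using dvd_diff[OF out[OF that] st[of q]] by simp
    have "int p dvd g i j"
    proof (rule lamps_periodic_zero[OF g(1)])
      show "int p dvd g (i + int q * E) j - g (i + int (Suc q) * E) j" for q
        using gg[of "int (Suc q)"] by (simp add: dvd_diff_commute)
    qed (use E(2) in auto)
    moreover have "int p dvd g (i - E) j"
    proof (rule lamps_periodic_zero[OF g(1)])
      show "int p dvd g (i - E + int q * (- E)) j - g (i - E + int (Suc q) * (- E)) j" for q
        using gg[of "- 1 - int q"] by (simp add: algebra_simps)
    qed (use E(2) in auto)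
    ultimately show ?thesis using st[of 0] dvd_diff[of "int p" "g i j" "g (i - E) j"]
      by (simp add: dvd_diff_right_iff dvd_diff_left_iff)
  qed (use f in \<open>auto simp: supp_within_def\<close>)
  show ?thesis unfolding mem_stretch_sub_iff[OF C]
  proof (intro conj_cong refl iffI; elim bexE)
    fix g assume g: "g \<in> lamps" "\<forall>i j. int p dvd f i j - (g i j - g (i - (e(r := E)) (i mod t)) j)"
    show "\<exists>g\<in>lamps. \<forall>i j. int p dvd f i j - (g i j - g (i - e (i mod t)) j)"
    proof (intro bexI[OF _ cut[OF g(1)]] allI cutI)
      show "int p dvd f i j" if "i mod t = r" for i j using zero[OF g(1) _ that] g(2) by blast
      show "int p dvd f i j - (g i j - g (i - e (i mod t)) j)" if "i mod t \<noteq> r" for i j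
        using g(2)[rule_format, of i j] that by simp
    qed simp
  next
    fix g assume g: "g \<in> lamps" "\<forall>i j. int p dvd f i j - (g i j - g (i - e (i mod t)) j)"
    show "\<exists>g\<in>lamps. \<forall>i j. int p dvd f i j - (g i j - g (i - (e(r := E)) (i mod t)) j)"
    proof (intro bexI[OF _ cut[OF g(1)]] allI cutI)
      show "int p dvd f i j" if "i mod t = r" for i j
        using g(2)[rule_format, of i j] that r by simp
      show "int p dvd f i j - (g i j - g (i - e (i mod t)) j)" for i j
        using g(2) by blast
    qed (rule disjI2, rule refl)
  qed
qed

text \<open>The element obtained from a single lamp at \<open>r\<close> separates the two: its value
  at \<open>r\<close> is 1, whereas \<open>e r = 0\<close> demands 0 there.\<close>

lemma stretch_sub_upd_ne:
  assumes r: "e r = 0" "r \<in> {0..<t}" and E: "E \<noteq> 0"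
  shows "stretch_sub t (e(r := E)) \<noteq> stretch_sub t e"
proof -
  define f where "f = spike r - stretch t (e(r := E)) (spike r)"
  have sup: "{i. \<exists>j. \<not> int p dvd stretch t (e(r := E)) (spike r) i j} \<subseteq> (\<lambda>s. r + (e(r := E)) s) ` {0..<t}"
  proof
    fix i assume "i \<in> {i. \<exists>j. \<not> int p dvd stretch t (e(r := E)) (spike r) i j}"
    then have "i - (e(r := E)) (i mod t) = r" by (auto simp: stretch_def spike_def split: if_splits)
    then show "i \<in> (\<lambda>s. r + (e(r := E)) s) ` {0..<t}" using r(2) by (intro image_eqI[of _ _ "i mod t"]) auto
  qed
  have "finite {i. \<exists>j. \<not> int p dvd stretch t (e(r := E)) (spike r) i j}"
    by (rule finite_subset[OF sup]) simp
  then have "stretch t (e(r := E)) (spike r) \<in> lamps"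
    using n1 by (auto simp: lamps_def stretch_def spike_def)
  then have "f \<in> lamps" unfolding f_def by (rule lamps_diff[OF spike_lamps])
  then have c: "(red f, 0) \<in> carrier G" by (simp only: red_in_carrier_iff)
  have "red (red f) = red (spike r - stretch t (e(r := E)) (spike r))" by (simp add: f_def)
  then have "(red f, 0) \<in> stretch_sub t (e(r := E))"
    unfolding stretch_sub_def using c spike_lamps by blast
  moreover have "(red f, 0) \<notin> stretch_sub t e"
  proof
    assume "(red f, 0) \<in> stretch_sub t e"
    then obtain g where "\<forall>i j. int p dvd red f i j - (g i j - g (i - e (i mod t)) j)"
      unfolding mem_stretch_sub_iff[OF c] by blast
    from this[rule_format, of r 0] have "int p dvd f r 0" using r by (simp add: dvd_mod_iff)
    then show False using not_p_dvd_1 E r by (simp add: f_def stretch_def spike_def)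
  qed
  ultimately show ?thesis by blast
qed

text \<open>Each zero of \<open>e\<close> pays for one derivative: replacing it by large multiples
  of \<open>t\<close> gives subgroups with one zero fewer that converge to the given one.\<close>

lemma stretch_sub_in_stage:
  assumes "\<And>r. t dvd e r" "0 < t" "k \<le> card {r \<in> {0..<t}. e r = 0}"
  shows "stretch_sub t e \<in> stage k"
  using assms
proof (induction k arbitrary: e)
  case 0
  show ?case using subgroup_stretch_sub by (simp add: stage_def)
next
  case (Suc k)
  have "\<exists>K\<in>stage k. K \<noteq> stretch_sub t e \<and> K \<inter> F = stretch_sub t e \<inter> F" if F: "finite F" for F
  proof -
    obtain B :: nat where B: "\<And>f k. (f, k) \<in> F \<Longrightarrow> (f, k) \<in> carrier G \<Longrightarrow> supp_within (- int B) (int B) f"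
      by (rule finite_carrier_bound[OF F]) blast
    have "{r \<in> {0..<t}. e r = 0} \<noteq> {}" using Suc.prems(3) by (intro notI) (simp only: card.empty)
    then obtain r where r: "r \<in> {0..<t}" "e r = 0" by blast
    \<comment> \<open>The factor \<open>t\<close> preserves divisibility, and the other factor makes
      \<open>E\<close> larger than the width of the window containing the supports in
      \<open>F\<close>.\<close>
    define E where "E = t * (2 * int B + 1)"
    have "1 * (2 * int B + 1) \<le> E" unfolding E_def using Suc.prems(2) by (intro mult_right_mono) auto
      then have "2 * int B < E" by simp
    moreover from this have "E \<noteq> 0" by auto
    moreover have "t dvd E" by (simp add: E_def)
    ultimately have E: "t dvd E" "2 * int B < E" "E \<noteq> 0" by blast+
    define e' where "e' = e(r := E)"
    have "{s \<in> {0..<t}. e' s = 0} = {s \<in> {0..<t}. e s = 0} - {r}" using E(3) by (auto simp: e'_def)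
    then have "k \<le> card {s \<in> {0..<t}. e' s = 0}" using Suc.prems(3) r by simp
    moreover have "t dvd e' s" for s using Suc.prems(1) E(1) by (simp add: e'_def)
    ultimately have "stretch_sub t e' \<in> stage k" using Suc.IH Suc.prems(2) by blast
    moreover have "stretch_sub t e' \<noteq> stretch_sub t e"
      unfolding e'_def by (rule stretch_sub_upd_ne) (use r E(3) in simp_all)
    moreover have "x \<in> stretch_sub t e' \<longleftrightarrow> x \<in> stretch_sub t e" if "x \<in> F" "x \<in> carrier G" for x
    proof -
      obtain f m where x: "x = (f, m)" by force
      show ?thesis unfolding x e'_def
        by (rule stretch_sub_agree[where B = B])
          (use Suc.prems(1) r(2) E B that in \<open>simp_all add: x\<close>)
    qed
    then have "stretch_sub t e' \<inter> F = stretch_sub t e \<inter> F"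
      using subgroup.subset[OF subgroup_stretch_sub] by blast
    ultimately show ?thesis by (intro bexI[of _ "stretch_sub t e'"] conjI)
  qed
  moreover have "stretch_sub t e \<in> stage k" using Suc by simp
  ultimately show ?case by (simp add: stage_Suc sub_deriv_def)
qed

text \<open>Equality at one step would freeze the sequence, so \<open>stage k\<close> would consist
  of subgroups of the lamp group only.\<close>

lemma stage_strict: "stage k \<noteq> stage (Suc k)"
proof
  assume eq: "stage k = stage (Suc k)"
  have "sub_deriv (stage k) = stage k" using eq by (simp only: stage_Suc)
  then have "stage (k + m) = stage k" for m
    by (induction m) (simp_all add: stage_Suc)
  then have all: "stage k \<subseteq> stage m" for m
    using stage_antimono[of m "k + m"] by simp
  \<comment> \<open>With all exponents zero this is the cyclic group generated by
    \<open>(0, k + 1)\<close>. Taking \<open>k + 1\<close> rather than \<open>k\<close> keeps the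
    modulus positive when \<open>k = 0\<close>.\<close>
  define H where "H = stretch_sub (int k + 1) (\<lambda>_. 0)"
  have "{r \<in> {0..<int k + 1}. (0::int) = 0} = {0..<int k + 1}" by blast
  then have "k \<le> card {r \<in> {0..<int k + 1}. (0::int) = 0}" by (simp only: card_atLeastLessThan_int)
  then have "H \<in> stage k" unfolding H_def by (intro stretch_sub_in_stage) simp_all
  then have "H \<in> base_subgroups" using all Inter_stage by blast
  have c: "(0, int k + 1) \<in> carrier G"
    using red_in_carrier_iff[of 0 "int k + 1"] lamps_zero by (simp only: red_zero)
  have "(0, int k + 1) \<in> H" unfolding H_def mem_stretch_sub_iff[OF c]
    using lamps_zero by (intro conjI bexI[of _ 0]) auto
  then have "int k + 1 = 0" using \<open>H \<in> base_subgroups\<close> unfolding base_subgroups_def by blast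
  then show False by simp
qed

lemma is_CB_rank_lamplighter:
  fixes \<alpha> :: "'i::wellorder"
  shows "is_CB_rank (Sub_space G) \<alpha> \<longleftrightarrow> infinite {..<\<alpha>} \<and> (\<forall>\<beta><\<alpha>. finite {..<\<beta>})"
  by (rule is_CB_rank_Sub_space_omega; fold stage_def) (simp_all only: Inter_stage sub_deriv_base stage_strict not_False_eq_True)

end

theorem theorem6p6:
  fixes p n :: nat and \<alpha> :: "'i::wellorder"
  assumes "prime p" and "1 \<le> n"
  shows "is_CB_rank (Sub_space (lamplighter n p)) \<alpha> \<longleftrightarrow> is_poset_CB_rank Q_less Q_set \<alpha>"
proof -
  interpret lamp n p using assms by unfold_locales (auto dest: prime_ge_2_nat)
  show ?thesis by (simp only: is_CB_rank_lamplighter is_poset_CB_rank_Q)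
qed

end
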